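(* Universality for residual nominal automata is decidable: there is an algorithm which, given a residual nominal automaton $\mathcal{A}$ over an orbit-finite alphabet $\Sigma$, decides whether $\mathcal{L}(\mathcal{A})=\Sigma^*$.
   Context: Nominal sets: $\mathbb{A}$ is a countably infinite set of atoms and $\mathrm{Perm}(\mathbb{A})$ is the group of finite permutations of $\mathbb{A}$. A nominal set is a set with a $\mathrm{Perm}(\mathbb{A})$-action in which every element $x$ has a finite support (a finite $A\subseteq\mathbb{A}$ such that $\pi x=x$ whenever $\pi$ fixes $A$ pointwise). A subset $U$ is equivariant if $\pi U=U$ for all $\pi$. A nominal set is orbit-finite if it is a finite union of orbits. A nominal automaton consists of an orbit-finite nominal alphabet $\Sigma$, an orbit-finite nominal set $Q$ of states, and equivariant subsets $I\subseteq Q$ (initial), $F\subseteq Q$ (final), $\delta\subseteq Q\times\Sigma\times Q$ (transitions), with the usual (nondeterministic) acceptance; $[\![q]\!]$ is the language accepted from $q$. It is residual if for each $q\in Q$ there is a word $w\in\Sigma^*$ with $[\![q]\!]=w^{-1}\mathcal{L}(\mathcal{A})=\{v\mid wv\in\mathcal{L}(\mathcal{A})\}$. Nominal automata are given as input by a standard finite representation of orbit-finite sets and equivariant relations (orbit-finite sets are effectively finitely representable, and "computation with atoms" over them, e.g. looping over an orbit-finite set, is equivalent to ordinary computability). The input is promised to be residual. *)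

theory Defs
  imports "HOL-Combinatorics.Perm" "HOL-Library.Nat_Bijection"
begin

section \<open>Nominal sets\<close>

text \<open>The countably infinite set of atoms is \<^typ>\<open>nat\<close>; its group of finite permutations is the
  library type \<^typ>\<open>nat perm\<close>, whose application function is \<^const>\<open>Perm.apply\<close>.\<close>

type_synonym atom = nat

type_synonym 'x action = "atom perm \<Rightarrow> 'x \<Rightarrow> 'x"

definition supports :: "'x action \<Rightarrow> atom set \<Rightarrow> 'x \<Rightarrow> bool" where
  "supports act A x \<longleftrightarrow> (\<forall>\<pi>. (\<forall>a\<in>A. Perm.apply \<pi> a = a) \<longrightarrow> act \<pi> x = x)"

definition nominal_set :: "'x set \<Rightarrow> 'x action \<Rightarrow> bool" where
  "nominal_set X act \<longleftrightarrow>
     (\<forall>x\<in>X. act 1 x = x \<and>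
       (\<forall>\<pi>. act \<pi> x \<in> X) \<and>
       (\<forall>\<pi> \<sigma>. act (\<pi> * \<sigma>) x = act \<pi> (act \<sigma> x)) \<and>
       (\<exists>A. finite A \<and> supports act A x))"

definition orbit_of :: "'x action \<Rightarrow> 'x \<Rightarrow> 'x set" where
  "orbit_of act x = range (\<lambda>\<pi>. act \<pi> x)"

definition orbit_finite :: "'x set \<Rightarrow> 'x action \<Rightarrow> bool" where
  "orbit_finite X act \<longleftrightarrow> (\<exists>R. finite R \<and> R \<subseteq> X \<and> X = (\<Union>x\<in>R. orbit_of act x))"

definition equivariant :: "'x action \<Rightarrow> 'x set \<Rightarrow> bool" where
  "equivariant act U \<longleftrightarrow> (\<forall>\<pi>. act \<pi> ` U = U)"


section \<open>Nominal automata\<close>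

record ('a, 'q) automaton =
  alphabet :: "'a set"
  letter_act :: "'a action"
  states :: "'q set"
  state_act :: "'q action"
  initial :: "'q set"
  final :: "'q set"
  transitions :: "('q \<times> 'a \<times> 'q) set"

definition trans_act :: "('a, 'q) automaton \<Rightarrow> ('q \<times> 'a \<times> 'q) action" where
  "trans_act A \<pi> = (\<lambda>(q, a, q'). (state_act A \<pi> q, letter_act A \<pi> a, state_act A \<pi> q'))"

definition nominal_automaton :: "('a, 'q) automaton \<Rightarrow> bool" where
  "nominal_automaton A \<longleftrightarrow>
     nominal_set (alphabet A) (letter_act A) \<and> orbit_finite (alphabet A) (letter_act A) \<and>
     nominal_set (states A) (state_act A) \<and> orbit_finite (states A) (state_act A) \<and>
     initial A \<subseteq> states A \<and> equivariant (state_act A) (initial A) \<and>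
     final A \<subseteq> states A \<and> equivariant (state_act A) (final A) \<and>
     transitions A \<subseteq> states A \<times> alphabet A \<times> states A \<and> equivariant (trans_act A) (transitions A)"

fun accepts_from :: "('a, 'q) automaton \<Rightarrow> 'q \<Rightarrow> 'a list \<Rightarrow> bool" where
  "accepts_from A q [] \<longleftrightarrow> q \<in> final A"
| "accepts_from A q (a # w) \<longleftrightarrow> (\<exists>q'. (q, a, q') \<in> transitions A \<and> accepts_from A q' w)"

definition state_language :: "('a, 'q) automaton \<Rightarrow> 'q \<Rightarrow> 'a list set" where
  "state_language A q = {w \<in> lists (alphabet A). accepts_from A q w}"

definition language :: "('a, 'q) automaton \<Rightarrow> 'a list set" where
  "language A = (\<Union>q\<in>initial A. state_language A q)"

definition residual :: "('a, 'q) automaton \<Rightarrow> bool" where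
  "residual A \<longleftrightarrow>
     (\<forall>q\<in>states A. \<exists>w\<in>lists (alphabet A). state_language A q = {v. w @ v \<in> language A})"

definition universal :: "('a, 'q) automaton \<Rightarrow> bool" where
  "universal A \<longleftrightarrow> language A = lists (alphabet A)"


section \<open>Finite presentations\<close>

text \<open>A pair \<open>(k, G)\<close> presents the single-orbit nominal set of \<open>k\<close>-tuples of distinct atoms
  modulo the group \<open>G\<close> of permutations of \<open>{..<k}\<close>. The permutation \<open>g\<close> is the list
  \<open>[g 0, \<dots>, g (k - 1)]\<close>, and \<open>G\<close> is listed in full, not by generators. A finite nonempty set
  of permutations closed under composition is a group, so inverses need not be mentioned.\<close>

type_synonym orbit_spec = "nat \<times> nat list list"

definition wf_orbit :: "orbit_spec \<Rightarrow> bool" where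
  "wf_orbit = (\<lambda>(k, G).
     [0..<k] \<in> set G \<and>
     (\<forall>g\<in>set G. distinct g \<and> set g = {..<k}) \<and>
     (\<forall>g\<in>set G. \<forall>h\<in>set G. map ((!) g) h \<in> set G))"

text \<open>A list of such pairs presents the disjoint union of the corresponding orbits. Its elements
  have names \<open>(i, t)\<close>, where \<open>t\<close> is a tuple of distinct atoms of the arity of the \<open>i\<close>-th orbit;
  the element named \<open>(i, t)\<close> is the class of \<open>t\<close> modulo the group, tagged with \<open>i\<close>.\<close>

type_synonym name = "nat \<times> atom list"

type_synonym element = "nat \<times> atom list set"

definition names :: "orbit_spec list \<Rightarrow> name set" where
  "names os = {(i, t). i < length os \<and> length t = fst (os ! i) \<and> distinct t}"

definition element :: "orbit_spec list \<Rightarrow> name \<Rightarrow> element" where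
  "element os = (\<lambda>(i, t). (i, {map ((!) t) g | g. g \<in> set (snd (os ! i))}))"

definition element_act :: "element action" where
  "element_act \<pi> = (\<lambda>(i, T). (i, map (Perm.apply \<pi>) ` T))"

text \<open>An equivariant set of states is given by the indices of its orbits, the equivariant
  transition relation by names of one or more representatives of each of its orbits.\<close>

record presentation =
  letter_orbits :: "orbit_spec list"
  state_orbits :: "orbit_spec list"
  initial_orbits :: "nat list"
  final_orbits :: "nat list"
  trans_reps :: "(name \<times> name \<times> name) list"

definition wf_presentation :: "presentation \<Rightarrow> bool" where
  "wf_presentation p \<longleftrightarrow>
     (\<forall>r\<in>set (letter_orbits p). wf_orbit r) \<and>
     (\<forall>r\<in>set (state_orbits p). wf_orbit r) \<and>
     set (initial_orbits p) \<subseteq> {..<length (state_orbits p)} \<and>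
     set (final_orbits p) \<subseteq> {..<length (state_orbits p)} \<and>
     set (trans_reps p) \<subseteq>
       names (state_orbits p) \<times> names (letter_orbits p) \<times> names (state_orbits p)"

definition presented :: "presentation \<Rightarrow> (element, element) automaton" where
  "presented p = \<lparr>
     alphabet = element (letter_orbits p) ` names (letter_orbits p),
     letter_act = element_act,
     states = element (state_orbits p) ` names (state_orbits p),
     state_act = element_act,
     initial = element (state_orbits p) `
       {(i, t) \<in> names (state_orbits p). i \<in> set (initial_orbits p)},
     final = element (state_orbits p) `
       {(i, t) \<in> names (state_orbits p). i \<in> set (final_orbits p)},
     transitions = {(element_act \<pi> (element (state_orbits p) m),
               element_act \<pi> (element (letter_orbits p) a),
               element_act \<pi> (element (state_orbits p) n)) | \<pi> m a n.
               (m, a, n) \<in> set (trans_reps p)}\<rparr>"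

definition encode_orbit :: "orbit_spec \<Rightarrow> nat" where
  "encode_orbit = (\<lambda>(k, G). prod_encode (k, list_encode (map list_encode G)))"

definition encode_name :: "name \<Rightarrow> nat" where
  "encode_name = (\<lambda>(i, t). prod_encode (i, list_encode t))"

definition encode_rep :: "name \<times> name \<times> name \<Rightarrow> nat" where
  "encode_rep = (\<lambda>(m, a, n).
     prod_encode (encode_name m, prod_encode (encode_name a, encode_name n)))"

definition encode_presentation :: "presentation \<Rightarrow> nat" where
  "encode_presentation p = list_encode
     [list_encode (map encode_orbit (letter_orbits p)),
      list_encode (map encode_orbit (state_orbits p)),
      list_encode (initial_orbits p),
      list_encode (final_orbits p),
      list_encode (map encode_rep (trans_reps p))]"


section \<open>Algorithms\<close>

text \<open>Kleene's partial recursive functions; \<^term>\<open>None\<close> stands for divergence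
  (and for arguments of the wrong number).\<close>

datatype recf =
    Zero
  | Succ
  | Proj nat
  | Comp recf "recf list"
  | PrimRec recf recf
  | Mu recf

fun eval :: "recf \<Rightarrow> nat list \<Rightarrow> nat option" where
  "eval Zero xs = Some 0"
| "eval Succ xs = (case xs of [x] \<Rightarrow> Some (Suc x) | _ \<Rightarrow> None)"
| "eval (Proj i) xs = (if i < length xs then Some (xs ! i) else None)"
| "eval (Comp f gs) xs =
     (let ys = map (\<lambda>g. eval g xs) gs
      in if None \<in> set ys then None else eval f (map the ys))"
| "eval (PrimRec f g) xs =
     (case xs of
        [] \<Rightarrow> None
      | n # xs' \<Rightarrow>
          rec_nat (eval f xs')
            (\<lambda>m r. case r of None \<Rightarrow> None | Some y \<Rightarrow> eval g (m # y # xs')) n)"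
| "eval (Mu f) xs =
     (if \<exists>n. eval f (n # xs) = Some 0 \<and> (\<forall>m<n. eval f (m # xs) \<noteq> None)
      then Some (LEAST n. eval f (n # xs) = Some 0)
      else None)"

text \<open>Decidability of a promise problem: nothing is required, not even termination, on
  instances that violate the promise.\<close>

definition decidable_under_promise ::
    "('i \<Rightarrow> nat) \<Rightarrow> ('i \<Rightarrow> bool) \<Rightarrow> ('i \<Rightarrow> bool) \<Rightarrow> bool" where
  "decidable_under_promise encode promise P \<longleftrightarrow>
     (\<exists>f. \<forall>x. promise x \<longrightarrow> eval f [encode x] = Some (if P x then 1 else 0))"


section \<open>Adequacy of the presentations\<close>

text \<open>Every well-formed presentation denotes a nominal automaton, every nominal automaton is
  isomorphic to a presented one, and residuality and universality are invariant under
  isomorphism. So nothing is lost by running algorithms on presentations.\<close>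

definition isomorphic :: "('a, 'q) automaton \<Rightarrow> ('b, 'r) automaton \<Rightarrow> bool" where
  "isomorphic A B \<longleftrightarrow> (\<exists>f g.
     bij_betw f (alphabet A) (alphabet B) \<and>
     (\<forall>\<pi>. \<forall>a\<in>alphabet A. f (letter_act A \<pi> a) = letter_act B \<pi> (f a)) \<and>
     bij_betw g (states A) (states B) \<and>
     (\<forall>\<pi>. \<forall>q\<in>states A. g (state_act A \<pi> q) = state_act B \<pi> (g q)) \<and>
     g ` initial A = initial B \<and> g ` final A = final B \<and>
     (\<lambda>(q, a, q'). (g q, f a, g q')) ` transitions A = transitions B)"

lemma perm_extend:
  fixes s t :: "atom list"
  assumes "distinct s" "distinct t" "length s = length t"
  shows "\<exists>\<pi>. map (Perm.apply \<pi>) s = t"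
proof -
  define U where "U = set s \<union> set t"
  have fU: "finite U" by (simp add: U_def)
  define f where "f x = t ! (THE i. i < length s \<and> s ! i = x)" for x
  have f_nth: "f (s ! i) = t ! i" if "i < length s" for i
  proof -
    have "(THE j. j < length s \<and> s ! j = s ! i) = i"
      using that assms(1) by (intro the_equality) (auto simp: nth_eq_iff_index_eq)
    then show ?thesis by (simp add: f_def)
  qed
  have bf: "bij_betw f (set s) (set t)"
  proof (rule bij_betwI')
    fix x y assume "x \<in> set s" "y \<in> set s"
    then show "(f x = f y) = (x = y)"
      using f_nth assms by (metis in_set_conv_nth nth_eq_iff_index_eq)
  next
    fix x assume "x \<in> set s" then show "f x \<in> set t"
      using f_nth assms by (metis in_set_conv_nth nth_mem)
  next
    fix y assume "y \<in> set t" then show "\<exists>x\<in>set s. y = f x"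
      using f_nth assms by (metis in_set_conv_nth nth_mem)
  qed
  have "card (U - set s) = card (U - set t)"
    using assms by (simp add: U_def card_Diff_subset distinct_card)
  then obtain g where bg: "bij_betw g (U - set s) (U - set t)"
    using fU by (metis finite_Diff finite_same_card_bij)
  define h where "h x = (if x \<in> U then (if x \<in> set s then f x else g x) else x)" for x
  have b1: "bij_betw h (set s) (set t)"
    using bf by (subst bij_betw_cong[where g = f]) (auto simp: h_def U_def)
  have b2: "bij_betw h (U - set s) (U - set t)"
    using bg by (subst bij_betw_cong[where g = g]) (auto simp: h_def)
  have b3: "bij_betw h (- U) (- U)"
    by (subst bij_betw_cong[where g = id]) (auto simp: h_def)
  have "bij_betw h (set s \<union> (U - set s)) (set t \<union> (U - set t))"
    by (rule bij_betw_combine[OF b1 b2]) auto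
  then have b4: "bij_betw h U U"
    by (simp add: U_def Un_absorb1 sup_commute)
  have "bij_betw h (U \<union> - U) (U \<union> - U)"
    by (rule bij_betw_combine[OF b4 b3]) auto
  then have "bij h" by simp
  moreover have "finite {a. h a \<noteq> a}"
    by (rule finite_subset[OF _ fU]) (auto simp: h_def)
  ultimately have ap: "Perm.apply (Perm h) = h"
    by (intro Perm_inverse) simp
  have "map (Perm.apply (Perm h)) s = t"
    using assms f_nth by (intro nth_equalityI) (auto simp: ap h_def U_def)
  then show ?thesis by blast
qed

lemma apply_inverse_apply [simp]:
  "Perm.apply (inverse \<pi>) (Perm.apply \<pi> a) = a"
  "Perm.apply \<pi> (Perm.apply (inverse \<pi>) a) = a"
  by (simp_all add: apply_sequence)

lemma perm_agree:
  assumes "map (Perm.apply \<pi>) t = map (Perm.apply \<sigma>) t" "a \<in> set t"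
  shows "Perm.apply (inverse \<sigma> * \<pi>) a = a"
  using assms by (simp add: apply_times)

context
  fixes X :: "'x set" and act :: "'x action"
  assumes ns: "nominal_set X act"
begin

lemma ns_one: "x \<in> X \<Longrightarrow> act 1 x = x"
  and ns_closed: "x \<in> X \<Longrightarrow> act \<pi> x \<in> X"
  and ns_times: "x \<in> X \<Longrightarrow> act (\<pi> * \<sigma>) x = act \<pi> (act \<sigma> x)"
  and ns_supp: "x \<in> X \<Longrightarrow> \<exists>A. finite A \<and> supports act A x"
  using ns unfolding nominal_set_def by blast+

lemma ns_inverse: "x \<in> X \<Longrightarrow> act (inverse \<pi>) (act \<pi> x) = x" "x \<in> X \<Longrightarrow> act \<pi> (act (inverse \<pi>) x) = x"
  using ns_times[of x "inverse \<pi>" \<pi>] ns_times[of x \<pi> "inverse \<pi>"] ns_one by auto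

lemma ns_eq_iff: "x \<in> X \<Longrightarrow> act \<pi> x = act \<sigma> x \<longleftrightarrow> act (inverse \<sigma> * \<pi>) x = x"
  by (metis ns_closed ns_inverse ns_times)

lemma supports_act:
  assumes "x \<in> X" "supports act A x"
  shows "supports act (Perm.apply \<pi> ` A) (act \<pi> x)"
  unfolding supports_def
proof (intro allI impI)
  fix \<sigma> assume "\<forall>a\<in>Perm.apply \<pi> ` A. Perm.apply \<sigma> a = a"
  then have "\<forall>a\<in>A. Perm.apply (inverse \<pi> * (\<sigma> * \<pi>)) a = a" by (simp add: apply_times)
  then have "act (inverse \<pi> * (\<sigma> * \<pi>)) x = x" using assms by (auto simp: supports_def)
  then show "act \<sigma> (act \<pi> x) = act \<pi> x"
    using ns_eq_iff[OF assms(1), of "\<sigma> * \<pi>" \<pi>] assms by (simp add: ns_times)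
qed

lemma supports_Int:
  assumes x: "x \<in> X" and A: "finite A" "supports act A x" and B: "finite B" "supports act B x"
  shows "supports act (A \<inter> B) x"
proof -
  have sw1: "Perm.apply (Perm.swap a b) c = (if c = a then b else if c = b then a else c)" for a b c :: atom
    by (simp add: Perm.swap.rep_eq transpose_def)
  have act_AB: "act (\<rho> * \<rho>') x = x" if "act \<rho> x = x" "act \<rho>' x = x" for \<rho> \<rho>'
    using ns_times[OF x, of \<rho> \<rho>'] that by simp
  have fixA: "act (Perm.swap a b) x = x" if "a \<notin> A" "b \<notin> A" for a b
    using A(2) that unfolding supports_def by (metis sw1)
  have fixB: "act (Perm.swap a b) x = x" if "a \<notin> B" "b \<notin> B" for a b
    using B(2) that unfolding supports_def by (metis sw1)
  have mix: "act (Perm.swap a b) x = x" if "a \<notin> A" "b \<notin> B" for a b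
  proof (cases "b \<in> A \<and> a \<in> B \<and> a \<noteq> b")
    case False
    then show ?thesis
      using that fixA fixB x ns_one by (metis swap_self)
  next
    case True
    obtain c where c: "c \<notin> A \<union> B \<union> {a, b}"
      using ex_new_if_finite[of "A \<union> B \<union> {a, b}"] A B by auto
    have "Perm.swap a b = Perm.swap a c * (Perm.swap b c * Perm.swap a c)"
      using c True by (intro perm_eqI) (auto simp: apply_times sw1)
    then show ?thesis
      using act_AB fixA[of a c] fixB[of b c] that c by simp
  qed
  have sw: "act (Perm.swap a b) x = x" if "a \<notin> A \<inter> B" "b \<notin> A \<inter> B" for a b
  proof -
    have "Perm.swap a b = Perm.swap b a" by (intro perm_eqI) (auto simp: sw1)
    then show ?thesis using that mix[of a b] mix[of b a] fixA fixB by (metis IntI)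
  qed
  have "act \<pi> x = x" if "affected \<pi> \<inter> (A \<inter> B) = {}" for \<pi>
    using that
  proof (induction "card (affected \<pi>)" arbitrary: \<pi> rule: less_induct)
    case less
    show ?case
    proof (cases "\<pi> = 1")
      case True then show ?thesis using x ns_one by simp
    next
      case False
      then obtain a where a: "a \<in> affected \<pi>" by (metis affected_empty_iff ex_in_conv)
      define b where "b = Perm.apply \<pi> a"
      have b: "b \<in> affected \<pi>" "b \<noteq> a" using a by (auto simp: b_def in_affected[of a])
      define \<rho> where "\<rho> = Perm.swap a b * \<pi>"
      have ra: "a \<notin> affected \<rho>" by (simp add: in_affected \<rho>_def apply_times sw1 b_def)
      have "affected \<rho> \<subseteq> affected \<pi>"
      proof
        fix c assume "c \<in> affected \<rho>"
        then show "c \<in> affected \<pi>"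
          using a b by (cases "c = a \<or> c = b") (auto simp: in_affected \<rho>_def apply_times sw1 split: if_splits)
      qed
      then have sub: "affected \<rho> \<subset> affected \<pi>" using ra a by blast
      then have "act \<rho> x = x" using less by (intro less.hyps) (auto intro!: psubset_card_mono)
      moreover have "act (Perm.swap a b) x = x" using a b less.prems by (intro sw) auto
      moreover have "\<pi> = Perm.swap a b * \<rho>"
        by (intro perm_eqI) (auto simp: \<rho>_def apply_times sw1)
      ultimately show ?thesis using act_AB by simp
    qed
  qed
  then show ?thesis unfolding supports_def by (metis disjoint_iff in_affected)
qed

lemma orbit_presentable:
  assumes x: "x \<in> X"
  shows "\<exists>k G t. wf_orbit (k, G) \<and> length t = k \<and> distinct t \<and>
    (\<forall>\<pi> \<sigma>. act \<pi> x = act \<sigma> x \<longleftrightarrow>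
       map (Perm.apply \<pi>) ` {map ((!) t) g | g. g \<in> set G} =
       map (Perm.apply \<sigma>) ` {map ((!) t) g | g. g \<in> set G})"
proof -
  define P where "P = (\<lambda>n. \<exists>A. finite A \<and> supports act A x \<and> card A = n)"
  have "\<exists>n. P n" using ns_supp[OF x] by (auto simp: P_def)
  then have "P (LEAST n. P n)" by (rule LeastI_ex)
  then obtain A where A: "finite A" "supports act A x" "card A = (LEAST n. P n)"
    by (auto simp: P_def)
  have min: "card A \<le> card B" if "finite B" "supports act B x" for B
    unfolding A(3) using that by (intro Least_le) (auto simp: P_def)
  have stab: "Perm.apply \<pi> ` A = A" if "act \<pi> x = x" for \<pi>
  proof -
    let ?B = "Perm.apply \<pi> ` A"
    have B: "finite ?B" "supports act ?B x" using A supports_act[OF x A(2), of \<pi>] that by auto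
    have cB: "card ?B = card A" by (intro card_image) (simp add: inj_on_def apply_inj)
    have "card A \<le> card (A \<inter> ?B)" using supports_Int[OF x A(1,2) B] A by (intro min) auto
    then have "A \<inter> ?B = A" using A by (intro card_seteq) auto
    then show ?thesis using cB B(1) by (metis card_subset_eq inf.absorb_iff1)
  qed
  have "\<exists>t. set t = A \<and> distinct t" by (rule finite_distinct_list[OF A(1)])
  then obtain t where t: "set t = A" "distinct t" by blast
  define k where "k = length t"
  define K where "K = {g. distinct g \<and> set g = {..<k} \<and>
     (\<exists>\<pi>. act \<pi> x = x \<and> map (Perm.apply \<pi>) t = map ((!) t) g)}"
  have KI: "g \<in> K" if "distinct g" "set g = {..<k}" "act \<pi> x = x"
    "map (Perm.apply \<pi>) t = map ((!) t) g" for g \<pi>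
    unfolding K_def using that by blast
  have K1: "distinct g" "set g = {..<k}" if "g \<in> K" for g
    using that unfolding K_def by blast+
  have K2: "\<exists>\<pi>. act \<pi> x = x \<and> map (Perm.apply \<pi>) t = map ((!) t) g" if "g \<in> K" for g
    using that unfolding K_def by blast
  have K3: "length g = k" if "g \<in> K" for g
    using K1[OF that] distinct_card by fastforce
  have "K \<subseteq> {g. set g \<subseteq> {..<k} \<and> length g = k}"
    using K1 K3 by blast
  then have "finite K"
    by (rule finite_subset) (rule finite_lists_length_eq, simp)
  then obtain G where G: "set G = K" by (metis finite_list)
  have id: "[0..<k] \<in> K"
    by (rule KI[of _ 1]) (use ns_one[OF x] in \<open>auto simp: k_def map_nth\<close>)
  have comp: "map ((!) g) h \<in> K" if gh: "g \<in> K" "h \<in> K" for g h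
  proof -
    have g: "distinct g" "set g = {..<k}" and h: "distinct h" "set h = {..<k}"
      using that K1 by blast+
    obtain \<pi> where p1: "act \<pi> x = x" "map (Perm.apply \<pi>) t = map ((!) t) g"
      using K2[OF gh(1)] by blast
    obtain \<sigma> where p2: "act \<sigma> x = x" "map (Perm.apply \<sigma>) t = map ((!) t) h"
      using K2[OF gh(2)] by blast
    note ps = p1 p2
    have lg: "length g = k" "length h = k" using that K3 by blast+
    have "map (Perm.apply (\<pi> * \<sigma>)) t = map (Perm.apply \<pi>) (map (Perm.apply \<sigma>) t)"
      by (simp add: apply_times)
    also have "\<dots> = map (\<lambda>i. map (Perm.apply \<pi>) t ! i) h"
      using h(2) by (auto simp: ps(4) k_def)
    also have "\<dots> = map ((!) t) (map ((!) g) h)"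
      unfolding ps(2) using h(2) lg by auto
    finally have "map (Perm.apply (\<pi> * \<sigma>)) t = map ((!) t) (map ((!) g) h)" .
    moreover have "act (\<pi> * \<sigma>) x = x" using ns_times[OF x, of \<pi> \<sigma>] ps by simp
    moreover have "distinct (map ((!) g) h)"
      using g h lg by (auto simp: distinct_map inj_on_def nth_eq_iff_index_eq)
    moreover have "set (map ((!) g) h) = {..<k}"
      using g h lg by (metis list.set_map nth_image order_refl take_all lessThan_atLeast0)
    ultimately show ?thesis using KI by blast
  qed
  have wf: "wf_orbit (k, G)" using id comp K1 by (simp add: wf_orbit_def G)
  let ?S = "{map ((!) t) g | g. g \<in> set G}"
  have S: "?S = {map (Perm.apply \<rho>) t | \<rho>. act \<rho> x = x}"
  proof (intro equalityI subsetI)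
    fix s assume "s \<in> ?S" then show "s \<in> {map (Perm.apply \<rho>) t | \<rho>. act \<rho> x = x}"
      using K2 G by (smt (verit) mem_Collect_eq)
  next
    fix s assume "s \<in> {map (Perm.apply \<rho>) t | \<rho>. act \<rho> x = x}"
    then obtain \<rho> where r: "act \<rho> x = x" "s = map (Perm.apply \<rho>) t" by blast
    have ds: "distinct s" using t r by (auto simp: distinct_map inj_on_def apply_inj)
    have ss: "set s = set t" using r stab[OF r(1)] t by simp
    then have "\<exists>j<k. s ! i = t ! j" if "i < k" for i
      using that r(2) by (metis in_set_conv_nth k_def length_map nth_mem)
    then obtain j where j: "\<And>i. i < k \<Longrightarrow> j i < k \<and> s ! i = t ! j i" by metis
    have j1: "j i < k" and j2: "s ! i = t ! j i" if "i < k" for i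
      using j[OF that] by blast+
    have ls: "length s = k" by (simp add: r(2) k_def)
    let ?g = "map j [0..<k]"
    have inj: "inj_on j {..<k}"
    proof (rule inj_onI)
      fix i i' assume "i \<in> {..<k}" "i' \<in> {..<k}" "j i = j i'"
      then show "i = i'"
        using j2[of i] j2[of i'] nth_eq_iff_index_eq[OF ds, of i i'] ls by simp
    qed
    have "j ` {..<k} = {..<k}"
      by (rule endo_inj_surj[OF _ _ inj]) (use j1 in auto)
    then have "set ?g = {..<k}" by (simp add: atLeast0LessThan)
    moreover have "distinct ?g" using inj by (simp add: distinct_map atLeast0LessThan)
    moreover have "s = map ((!) t) ?g" by (rule nth_equalityI) (simp_all add: ls j2)
    ultimately show "s \<in> ?S" using KI[of ?g] r G by (smt (verit) mem_Collect_eq)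
  qed
  have dir: "map (Perm.apply \<pi>) ` ?S \<subseteq> map (Perm.apply \<sigma>) ` ?S"
    if eq: "act \<pi> x = act \<sigma> x" for \<pi> \<sigma>
  proof
    fix u assume "u \<in> map (Perm.apply \<pi>) ` ?S"
    then obtain \<rho> where r: "act \<rho> x = x" "u = map (Perm.apply \<pi>) (map (Perm.apply \<rho>) t)"
      unfolding S by auto
    have "act (inverse \<sigma> * (\<pi> * \<rho>)) x = x" using eq r ns_times[OF x] ns_eq_iff[OF x] by metis
    moreover have "u = map (Perm.apply \<sigma>) (map (Perm.apply (inverse \<sigma> * (\<pi> * \<rho>))) t)"
      using r by (simp add: apply_times)
    ultimately show "u \<in> map (Perm.apply \<sigma>) ` ?S" unfolding S by blast
  qed
  have conv: "act \<pi> x = act \<sigma> x" if eq: "map (Perm.apply \<pi>) ` ?S = map (Perm.apply \<sigma>) ` ?S" for \<pi> \<sigma>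
  proof -
    have "t \<in> ?S" unfolding S using ns_one[OF x] by (auto intro!: exI[of _ 1])
    then have "map (Perm.apply \<pi>) t \<in> map (Perm.apply \<sigma>) ` ?S" using eq by blast
    then obtain \<rho> where r: "act \<rho> x = x" "map (Perm.apply \<pi>) t = map (Perm.apply \<sigma>) (map (Perm.apply \<rho>) t)"
      unfolding S by auto
    then have "map (Perm.apply \<pi>) t = map (Perm.apply (\<sigma> * \<rho>)) t" by (simp add: apply_times)
    then have "act (inverse (\<sigma> * \<rho>) * \<pi>) x = x"
      using A(2) perm_agree[of \<pi> t "\<sigma> * \<rho>"] t(1) unfolding supports_def by blast
    then have "act \<pi> x = act (\<sigma> * \<rho>) x" using ns_eq_iff[OF x] by blast
    then show ?thesis using r(1) ns_times[OF x, of \<sigma> \<rho>] by simp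
  qed
  have main: "act \<pi> x = act \<sigma> x \<longleftrightarrow> map (Perm.apply \<pi>) ` ?S = map (Perm.apply \<sigma>) ` ?S" for \<pi> \<sigma>
  proof
    assume eq: "act \<pi> x = act \<sigma> x"
    show "map (Perm.apply \<pi>) ` ?S = map (Perm.apply \<sigma>) ` ?S"
      by (rule equalityI[OF dir[OF eq] dir[OF eq[symmetric]]])
  qed (rule conv)
  show ?thesis
    by (intro exI[of _ k] exI[of _ G] exI[of _ t] conjI allI)
      (rule wf, simp add: k_def, rule t, rule main)
qed

end

lemma equivariantI:
  assumes "nominal_set X act" "U \<subseteq> X" "\<And>\<pi> x. x \<in> U \<Longrightarrow> act \<pi> x \<in> U"
  shows "equivariant act U"
  unfolding equivariant_def
proof (intro allI equalityI subsetI)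
  fix \<pi> x assume "x \<in> U"
  then have "x = act \<pi> (act (inverse \<pi>) x)" using ns_inverse(2)[OF assms(1)] assms(2) by auto
  then show "x \<in> act \<pi> ` U" using assms(3)[OF \<open>x \<in> U\<close>] by blast
qed (use assms(3) in auto)

lemma nominal_set_triples:
  assumes "nominal_set (states A) (state_act A)" "nominal_set (alphabet A) (letter_act A)"
  shows "nominal_set (states A \<times> alphabet A \<times> states A) (trans_act A)"
proof -
  have "\<exists>S. finite S \<and> supports (trans_act A) S (q, a, q')"
    if q: "q \<in> states A" "a \<in> alphabet A" "q' \<in> states A" for q a q'
  proof -
    obtain S1 S2 S3 where "finite S1" "supports (state_act A) S1 q"
      "finite S2" "supports (letter_act A) S2 a" "finite S3" "supports (state_act A) S3 q'"
      using ns_supp[OF assms(1) q(1)] ns_supp[OF assms(2) q(2)] ns_supp[OF assms(1) q(3)] by metis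
    then show ?thesis
      by (intro exI[of _ "S1 \<union> S2 \<union> S3"]) (auto simp: supports_def trans_act_def)
  qed
  moreover have "trans_act A 1 (q, a, q') = (q, a, q')"
      "trans_act A \<pi> (q, a, q') \<in> states A \<times> alphabet A \<times> states A"
      "trans_act A (\<pi> * \<sigma>) (q, a, q') = trans_act A \<pi> (trans_act A \<sigma> (q, a, q'))"
    if q: "q \<in> states A" "a \<in> alphabet A" "q' \<in> states A" for q a q' \<pi> \<sigma>
    using that ns_one[OF assms(1)] ns_one[OF assms(2)] ns_closed[OF assms(1)] ns_closed[OF assms(2)]
      ns_times[OF assms(1)] ns_times[OF assms(2)] by (simp_all add: trans_act_def)
  ultimately show ?thesis unfolding nominal_set_def by auto
qed

abbreviation name_act :: "name action" where
  "name_act \<pi> \<equiv> \<lambda>(i, t). (i, map (Perm.apply \<pi>) t)"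

lemma names_act: "m \<in> names os \<Longrightarrow> name_act \<pi> m \<in> names os"
  by (auto simp: names_def distinct_map inj_on_def apply_inj)

lemma element_act_element:
  assumes "\<forall>r\<in>set os. wf_orbit r" "m \<in> names os"
  shows "element_act \<pi> (element os m) = element os (name_act \<pi> m)"
proof -
  obtain i t where m: "m = (i, t)" by fastforce
  have i: "i < length os" "length t = fst (os ! i)" using assms m by (auto simp: names_def)
  have "wf_orbit (os ! i)" using assms(1) i by auto
  then have g: "set g = {..<length t}" if "g \<in> set (snd (os ! i))" for g
    using that i by (auto simp: wf_orbit_def)
  have "map (Perm.apply \<pi>) (map ((!) t) g) = map ((!) (map (Perm.apply \<pi>) t)) g"
    if "g \<in> set (snd (os ! i))" for g
    using g[OF that] by simp
  then show ?thesis
    unfolding m element_act_def element_def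
    by (simp add: setcompr_eq_image image_image del: map_map cong: image_cong)
qed

abbreviation elements :: "orbit_spec list \<Rightarrow> element set" where
  "elements os \<equiv> element os ` names os"

lemma nominal_set_elements:
  assumes "\<forall>r\<in>set os. wf_orbit r"
  shows "nominal_set (elements os) element_act"
proof -
  have "supports element_act (set t) (element os (i, t))" if "(i, t) \<in> names os" for i t
    unfolding supports_def using element_act_element[OF assms that] by (simp add: map_idI)
  moreover have "element_act 1 e = e" for e by (cases e) (simp add: element_act_def)
  moreover have "element_act (\<pi> * \<sigma>) e = element_act \<pi> (element_act \<sigma> e)" for \<pi> \<sigma> e
    by (cases e) (simp add: element_act_def apply_times image_image)
  moreover have "element_act \<pi> (element os m) \<in> elements os" if "m \<in> names os" for \<pi> m
    using element_act_element[OF assms that] names_act[OF that] by auto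
  ultimately show ?thesis unfolding nominal_set_def by auto
qed

lemma orbit_finite_elements:
  assumes "\<forall>r\<in>set os. wf_orbit r"
  shows "orbit_finite (elements os) element_act"
proof -
  let ?R = "(\<lambda>i. (i, [0..<fst (os ! i)])) ` {..<length os}"
  have R: "?R \<subseteq> names os" by (auto simp: names_def)
  have "elements os \<subseteq> (\<Union>x\<in>element os ` ?R. orbit_of element_act x)"
  proof
    fix e assume "e \<in> elements os"
    then obtain i t where it: "(i, t) \<in> names os" "e = element os (i, t)" by auto
    then have i: "i < length os" "length t = fst (os ! i)" "distinct t" by (auto simp: names_def)
    then obtain \<pi> where p: "map (Perm.apply \<pi>) [0..<fst (os ! i)] = t"
      using perm_extend[of "[0..<fst (os ! i)]" t] by auto
    have m: "(i, [0..<fst (os ! i)]) \<in> ?R" using i by auto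
    then have "element_act \<pi> (element os (i, [0..<fst (os ! i)])) = e"
      using element_act_element[OF assms, of "(i, [0..<fst (os ! i)])" \<pi>] R p it(2) by auto
    then have "e \<in> orbit_of element_act (element os (i, [0..<fst (os ! i)]))"
      unfolding orbit_of_def by (metis rangeI)
    then show "e \<in> (\<Union>x\<in>element os ` ?R. orbit_of element_act x)" using m by blast
  qed
  moreover have "orbit_of element_act x \<subseteq> elements os" if "x \<in> element os ` ?R" for x
  proof -
    have "x \<in> elements os" using that R by blast
    then show ?thesis
      using ns_closed[OF nominal_set_elements[OF assms]] unfolding orbit_of_def by blast
  qed
  ultimately show ?thesis
    unfolding orbit_finite_def using R by (intro exI[of _ "element os ` ?R"]) blast
qed

theorem nominal_automaton_presented:
  assumes "wf_presentation p"
  shows "nominal_automaton (presented p)"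
proof -
  let ?A = "presented p"
  have wf: "\<forall>r\<in>set (letter_orbits p). wf_orbit r" "\<forall>r\<in>set (state_orbits p). wf_orbit r"
    and tr: "set (trans_reps p) \<subseteq>
       names (state_orbits p) \<times> names (letter_orbits p) \<times> names (state_orbits p)"
    using assms by (auto simp: wf_presentation_def)
  note ns = nominal_set_elements[OF wf(1)] nominal_set_elements[OF wf(2)]
  have eqv: "equivariant element_act
      (element (state_orbits p) ` {(i, t) \<in> names (state_orbits p). i \<in> J})" for J
  proof (rule equivariantI[OF ns(2)])
    fix \<pi> x assume "x \<in> element (state_orbits p) ` {(i, t) \<in> names (state_orbits p). i \<in> J}"
    then obtain i t where x: "x = element (state_orbits p) (i, t)" "(i, t) \<in> names (state_orbits p)" "i \<in> J"
      by auto
    then show "element_act \<pi> x \<in> element (state_orbits p) ` {(i, t) \<in> names (state_orbits p). i \<in> J}"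
      using element_act_element[OF wf(2) x(2), of \<pi>] names_act[OF x(2), of \<pi>] by auto
  qed auto
  have nsA: "nominal_set (states ?A \<times> alphabet ?A \<times> states ?A) (trans_act ?A)"
    using nominal_set_triples[of ?A] ns by (simp add: presented_def)
  have T: "transitions ?A \<subseteq> states ?A \<times> alphabet ?A \<times> states ?A"
  proof
    fix x assume "x \<in> transitions ?A"
    then obtain \<sigma> m a n where x: "x = (element_act \<sigma> (element (state_orbits p) m),
        element_act \<sigma> (element (letter_orbits p) a), element_act \<sigma> (element (state_orbits p) n))"
        "(m, a, n) \<in> set (trans_reps p)" by (auto simp: presented_def)
    have "m \<in> names (state_orbits p)" "a \<in> names (letter_orbits p)" "n \<in> names (state_orbits p)"
      using tr x(2) by auto
    then show "x \<in> states ?A \<times> alphabet ?A \<times> states ?A"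
      unfolding x(1) by (simp add: presented_def ns_closed[OF ns(1)] ns_closed[OF ns(2)])
  qed
  have "equivariant (trans_act ?A) (transitions ?A)"
  proof (rule equivariantI[OF nsA T])
    fix \<pi> x assume "x \<in> transitions ?A"
    then obtain \<sigma> m a n where x: "x = (element_act \<sigma> (element (state_orbits p) m),
        element_act \<sigma> (element (letter_orbits p) a), element_act \<sigma> (element (state_orbits p) n))"
        "(m, a, n) \<in> set (trans_reps p)" by (auto simp: presented_def)
    have mem: "m \<in> names (state_orbits p)" "a \<in> names (letter_orbits p)" "n \<in> names (state_orbits p)"
      using tr x(2) by auto
    have "trans_act ?A \<pi> x = (element_act (\<pi> * \<sigma>) (element (state_orbits p) m),
        element_act (\<pi> * \<sigma>) (element (letter_orbits p) a), element_act (\<pi> * \<sigma>) (element (state_orbits p) n))"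
      using mem by (simp add: x(1) trans_act_def presented_def ns_times[OF ns(1)] ns_times[OF ns(2)])
    moreover have "(element_act \<rho> (element (state_orbits p) m),
        element_act \<rho> (element (letter_orbits p) a),
        element_act \<rho> (element (state_orbits p) n)) \<in> transitions ?A" for \<rho>
      using x(2) unfolding presented_def automaton.simps by blast
    ultimately show "trans_act ?A \<pi> x \<in> transitions ?A" by simp
  qed
  then show ?thesis
    unfolding nominal_automaton_def
    using ns eqv T orbit_finite_elements[OF wf(1)] orbit_finite_elements[OF wf(2)]
    by (auto simp: presented_def)
qed


theorem nominal_set_presentable:
  assumes ns: "nominal_set X act" and fin: "orbit_finite X act"
  shows "\<exists>os h. (\<forall>r\<in>set os. wf_orbit r) \<and> bij_betw h X (elements os) \<and>
    (\<forall>\<pi>. \<forall>x\<in>X. h (act \<pi> x) = element_act \<pi> (h x))"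
proof -
  obtain R where R: "finite R" "R \<subseteq> X" "X = (\<Union>x\<in>R. orbit_of act x)"
    using fin unfolding orbit_finite_def by blast
  have self: "x \<in> orbit_of act x" if "x \<in> X" for x
    unfolding orbit_of_def using ns_one[OF ns that] by (metis rangeI)
  have orbit_eq: "orbit_of act y = orbit_of act x" if x: "x \<in> X" and y: "y \<in> orbit_of act x" for x y
  proof -
    obtain \<pi> where y: "y = act \<pi> x" using y by (auto simp: orbit_of_def)
    have "act \<sigma> y \<in> orbit_of act x" for \<sigma>
      using y ns_times[OF ns x, of \<sigma> \<pi>] unfolding orbit_of_def by (metis rangeI)
    moreover have "act \<sigma> x \<in> orbit_of act y" for \<sigma>
    proof -
      have "act (\<sigma> * inverse \<pi>) y = act \<sigma> x"
        using ns_times[OF ns ns_closed[OF ns x], of \<sigma> "inverse \<pi>" \<pi>] ns_inverse(1)[OF ns x, of \<pi>] y by simp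
      then show ?thesis unfolding orbit_of_def by (metis rangeI)
    qed
    ultimately show ?thesis unfolding orbit_of_def[of act y] orbit_of_def[of act x]
      by (auto simp: orbit_of_def)
  qed
  obtain Os where Os: "set Os = orbit_of act ` R" "distinct Os"
    using finite_distinct_list[of "orbit_of act ` R"] R(1) by blast
  define n where "n = length Os"
  have "\<exists>x. x \<in> X \<and> orbit_of act x = Os ! i" if "i < n" for i
  proof -
    have "Os ! i \<in> orbit_of act ` R" using that Os(1) n_def by (metis nth_mem)
    then show ?thesis using R(2) by blast
  qed
  then obtain x where x: "\<And>i. i < n \<Longrightarrow> x i \<in> X" "\<And>i. i < n \<Longrightarrow> orbit_of act (x i) = Os ! i"
    by metis
  define \<Phi> where "\<Phi> i k G t \<longleftrightarrow> wf_orbit (k, G) \<and> length t = k \<and> distinct t \<and>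
    (\<forall>\<pi> \<sigma>. act \<pi> (x i) = act \<sigma> (x i) \<longleftrightarrow>
       map (Perm.apply \<pi>) ` {map ((!) t) g | g. g \<in> set G} =
       map (Perm.apply \<sigma>) ` {map ((!) t) g | g. g \<in> set G})" for i k G t
  have "\<exists>k G t. \<Phi> i k G t" if "i < n" for i
    unfolding \<Phi>_def by (rule orbit_presentable[OF ns x(1)[OF that]])
  then obtain k G t where \<Phi>: "\<And>i. i < n \<Longrightarrow> \<Phi> i (k i) (G i) (t i)"
    by metis
  have kGt: "wf_orbit (k i, G i)" "length (t i) = k i" "distinct (t i)"
    "act \<pi> (x i) = act \<sigma> (x i) \<longleftrightarrow>
       map (Perm.apply \<pi>) ` {map ((!) (t i)) g | g. g \<in> set (G i)} =
       map (Perm.apply \<sigma>) ` {map ((!) (t i)) g | g. g \<in> set (G i)}" if "i < n" for i \<pi> \<sigma>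
    using \<Phi>[OF that] unfolding \<Phi>_def by blast+
  define os where "os = map (\<lambda>i. (k i, G i)) [0..<n]"
  have len: "length os = n" and nth: "\<And>i. i < n \<Longrightarrow> os ! i = (k i, G i)" by (simp_all add: os_def)
  have wf: "\<forall>r\<in>set os. wf_orbit r" using kGt(1) by (auto simp: os_def)
  have nm: "(i, t i) \<in> names os" if "i < n" for i
    using that kGt(2,3) nth by (simp add: names_def len)
  let ?e = "\<lambda>i. element os (i, t i)"
  have e_iff: "element_act \<pi> (?e i) = element_act \<sigma> (?e j) \<longleftrightarrow> i = j \<and> act \<pi> (x i) = act \<sigma> (x j)"
    if "i < n" "j < n" for \<pi> \<sigma> i j
  proof (cases "i = j")
    case True
    show ?thesis
      unfolding True element_act_def element_def case_prod_conv prod.inject nth[OF that(2)] snd_conv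
        kGt(4)[OF that(2)] by (rule refl)
  qed (simp add: element_act_def element_def)
  have cover: "\<exists>i \<pi>. i < n \<and> y = act \<pi> (x i)" if yX: "y \<in> X" for y
  proof -
    obtain z where z: "z \<in> R" "y \<in> orbit_of act z" using yX unfolding R(3) by blast
    then have "orbit_of act z \<in> set Os" using Os(1) by blast
    then obtain i where "i < n" "Os ! i = orbit_of act z" by (metis in_set_conv_nth n_def)
    then show ?thesis using z x(2) unfolding orbit_of_def by blast
  qed
  have idx: "i = j" if "i < n" "j < n" "act \<pi> (x i) = act \<sigma> (x j)" for i j \<pi> \<sigma>
  proof -
    have "act \<pi> (x i) \<in> orbit_of act (x i)" "act \<pi> (x i) \<in> orbit_of act (x j)"
      using that(3) unfolding orbit_of_def by blast+
    then have "Os ! i = Os ! j" using orbit_eq x that by metis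
    then show ?thesis using Os(2) that n_def nth_eq_iff_index_eq by blast
  qed
  obtain ix px where ip: "\<And>y. y \<in> X \<Longrightarrow> ix y < n" "\<And>y. y \<in> X \<Longrightarrow> y = act (px y) (x (ix y))"
    using cover by metis
  define h where "h y = element_act (px y) (?e (ix y))" for y
  have h: "h (act \<pi> (x i)) = element_act \<pi> (?e i)" if "i < n" for i \<pi>
  proof -
    have y: "act \<pi> (x i) \<in> X" using ns_closed[OF ns x(1)[OF that]] .
    have "ix (act \<pi> (x i)) = i" using idx[OF ip(1)[OF y] that] ip(2)[OF y] by metis
    then show ?thesis
      unfolding h_def using e_iff[OF ip(1)[OF y] that] ip(2)[OF y] by metis
  qed
  have nse: "nominal_set (elements os) element_act" by (rule nominal_set_elements[OF wf])
  have eqv: "h (act \<pi> y) = element_act \<pi> (h y)" if y: "y \<in> X" for \<pi> y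
  proof -
    obtain i \<sigma> where i: "i < n" "y = act \<sigma> (x i)" using cover[OF y] by blast
    have "act \<pi> y = act (\<pi> * \<sigma>) (x i)" using ns_times[OF ns x(1)[OF i(1)]] i(2) by simp
    then have "h (act \<pi> y) = element_act (\<pi> * \<sigma>) (?e i)" using h[OF i(1)] by simp
    also have "\<dots> = element_act \<pi> (element_act \<sigma> (?e i))" by (rule ns_times[OF nse]) (use nm i in blast)
    finally show ?thesis using h[OF i(1)] i(2) by simp
  qed
  have "bij_betw h X (elements os)"
  proof (rule bij_betwI')
    fix y z assume y: "y \<in> X" and z: "z \<in> X"
    obtain i \<sigma> where i: "i < n" "y = act \<sigma> (x i)" using cover[OF y] by blast
    obtain j \<rho> where j: "j < n" "z = act \<rho> (x j)" using cover[OF z] by blast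
    have "h y = h z \<longleftrightarrow> i = j \<and> y = z" using e_iff[OF i(1) j(1)] h i j by simp
    then show "h y = h z \<longleftrightarrow> y = z" using idx[OF i(1) j(1)] i j by metis
  next
    fix y assume y: "y \<in> X"
    obtain i \<sigma> where i: "i < n" "y = act \<sigma> (x i)" using cover[OF y] by blast
    show "h y \<in> elements os" using h[OF i(1)] i ns_closed[OF nse] nm by (metis image_eqI)
  next
    fix e assume "e \<in> elements os"
    then obtain i s where s: "(i, s) \<in> names os" "e = element os (i, s)" by auto
    then have i: "i < n" "length s = k i" "distinct s" using nth by (auto simp: names_def len)
    obtain \<pi> where p: "map (Perm.apply \<pi>) (t i) = s"
      using perm_extend[of "t i" s] i kGt(2,3)[OF i(1)] by auto
    have "element_act \<pi> (?e i) = e" using element_act_element[OF wf nm[OF i(1)], of \<pi>] p s(2) by simp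
    then have "e = h (act \<pi> (x i))" using h[OF i(1)] by simp
    then show "\<exists>y\<in>X. e = h y" using ns_closed[OF ns x(1)[OF i(1)]] by blast
  qed
  then show ?thesis using wf eqv by blast
qed

lemma invariant_names:
  assumes wf: "\<forall>r\<in>set os. wf_orbit r" and U: "U \<subseteq> elements os"
    and inv: "\<And>\<pi> e. e \<in> U \<Longrightarrow> element_act \<pi> e \<in> U"
  shows "\<exists>J. set J \<subseteq> {..<length os} \<and> U = element os ` {(i, t) \<in> names os. i \<in> set J}"
proof -
  obtain J where J: "set J = {i. i < length os \<and> (\<exists>t. (i, t) \<in> names os \<and> element os (i, t) \<in> U)}"
    using finite_list[of "{i. i < length os \<and> (\<exists>t. (i, t) \<in> names os \<and> element os (i, t) \<in> U)}"]
    by auto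
  have "element os (i, t) \<in> U" if it: "(i, t) \<in> names os" and i: "i \<in> set J" for i t
  proof -
    obtain s where s: "(i, s) \<in> names os" "element os (i, s) \<in> U"
      using i unfolding J by blast
    obtain \<pi> where "map (Perm.apply \<pi>) s = t"
      using perm_extend[of s t] it s by (auto simp: names_def)
    then have "element_act \<pi> (element os (i, s)) = element os (i, t)"
      using element_act_element[OF wf s(1), of \<pi>] by simp
    then show ?thesis using inv[OF s(2), of \<pi>] by simp
  qed
  moreover have "e \<in> element os ` {(i, t) \<in> names os. i \<in> set J}" if e: "e \<in> U" for e
  proof -
    obtain i t where it: "(i, t) \<in> names os" "e = element os (i, t)" using e U by auto
    moreover have "i < length os" using it by (simp add: names_def)
    ultimately have "i \<in> set J" using e J by auto
    then show ?thesis using it by blast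
  qed
  ultimately have "U = element os ` {(i, t) \<in> names os. i \<in> set J}" by blast
  moreover have "set J \<subseteq> {..<length os}" unfolding J by blast
  ultimately show ?thesis by blast
qed

lemma invariant_triples:
  assumes wf: "\<forall>r\<in>set os. wf_orbit r" "\<forall>r\<in>set ls. wf_orbit r"
    and T: "T \<subseteq> elements os \<times> elements ls \<times> elements os"
    and inv: "\<And>\<pi> x y z. (x, y, z) \<in> T \<Longrightarrow> (element_act \<pi> x, element_act \<pi> y, element_act \<pi> z) \<in> T"
  shows "\<exists>D. set D \<subseteq> names os \<times> names ls \<times> names os \<and>
    T = {(element_act \<pi> (element os m), element_act \<pi> (element ls a), element_act \<pi> (element os n))
         | \<pi> m a n. (m, a, n) \<in> set D}"
proof -
  define M where "M = Max (insert 0 (fst ` (set os \<union> set ls)))"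
  have M: "length t \<le> M" if "(i, t) \<in> names os \<or> (i, t) \<in> names ls" for i t
  proof -
    have "length t \<in> fst ` (set os \<union> set ls)" using that by (auto simp: names_def)
    then show ?thesis unfolding M_def by (intro Max_ge) auto
  qed
  define N where "N = {..<max (length os) (length ls)} \<times>
    {t. set t \<subseteq> {..<3 * M} \<and> length t \<le> M}"
  have "finite N" unfolding N_def using finite_lists_length_le[of "{..<3 * M}" M] by auto
  let ?D = "{(m, a, n) \<in> N \<times> N \<times> N. m \<in> names os \<and> a \<in> names ls \<and> n \<in> names os \<and>
    (element os m, element ls a, element os n) \<in> T}"
  have "finite ?D" by (rule finite_subset[of _ "N \<times> N \<times> N"]) (use \<open>finite N\<close> in auto)
  then obtain D where D: "set D = ?D" using finite_list by blast
  let ?T = "{(element_act \<pi> (element os m), element_act \<pi> (element ls a), element_act \<pi> (element os n))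
         | \<pi> m a n. (m, a, n) \<in> set D}"
  have "?T \<subseteq> T" unfolding D using inv by blast
  moreover have "T \<subseteq> ?T"
  proof
    fix w assume w: "w \<in> T"
    then obtain m a n where mem: "m \<in> names os" "a \<in> names ls" "n \<in> names os"
      and w_eq: "w = (element os m, element ls a, element os n)" using T by blast
    obtain i s j t l u where mm: "m = (i, s)" "a = (j, t)" "n = (l, u)" by fastforce
    obtain B where B: "set B = set s \<union> set t \<union> set u" "distinct B"
      using finite_distinct_list[of "set s \<union> set t \<union> set u"] by auto
    have "length B = card (set (s @ t @ u))" 
      using B distinct_card[of B] by (simp add: Un_assoc)
    also have "\<dots> \<le> length (s @ t @ u)" by (rule card_length)
    also have "\<dots> \<le> 3 * M" using M[of i s] M[of j t] M[of l u] mem mm by auto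
    finally have lB: "length B \<le> 3 * M" .
    obtain \<pi> where p: "map (Perm.apply \<pi>) B = [0..<length B]"
      using perm_extend[of B "[0..<length B]"] B by auto
    have "Perm.apply \<pi> b < length B" if "b \<in> set B" for b
      using that arg_cong[OF p, of set] by auto
    then have small: "Perm.apply \<pi> b < 3 * M" if "b \<in> set s \<union> set t \<union> set u" for b
      using that B lB by force
    have N: "name_act \<pi> m \<in> N" "name_act \<pi> a \<in> N" "name_act \<pi> n \<in> N"
      using small mem M[of i s] M[of j t] M[of l u] by (auto simp: mm N_def names_def)
    have E: "element os (name_act \<pi> m) = element_act \<pi> (element os m)"
      "element ls (name_act \<pi> a) = element_act \<pi> (element ls a)"
      "element os (name_act \<pi> n) = element_act \<pi> (element os n)"
      using element_act_element wf mem by metis+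
    have "(element os (name_act \<pi> m), element ls (name_act \<pi> a), element os (name_act \<pi> n)) \<in> T"
      unfolding E using inv w unfolding w_eq by blast
    then have d: "(name_act \<pi> m, name_act \<pi> a, name_act \<pi> n) \<in> set D"
      unfolding D using N names_act[OF mem(1)] names_act[OF mem(2)] names_act[OF mem(3)] by blast
    have "w = (element_act (inverse \<pi>) (element os (name_act \<pi> m)),
        element_act (inverse \<pi>) (element ls (name_act \<pi> a)),
        element_act (inverse \<pi>) (element os (name_act \<pi> n)))"
      unfolding E w_eq
      using ns_inverse(1)[OF nominal_set_elements[OF wf(1)]] ns_inverse(1)[OF nominal_set_elements[OF wf(2)]]
        mem by simp
    then show "w \<in> ?T" using d by blast
  qed
  ultimately have "T = ?T" by (rule equalityI[rotated])
  moreover have "set D \<subseteq> names os \<times> names ls \<times> names os" unfolding D by blast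
  ultimately show ?thesis by (rule exI[of _ D, OF conjI, rotated])
qed

theorem nominal_automaton_presentable:
  assumes A: "nominal_automaton A"
  shows "\<exists>p. wf_presentation p \<and> isomorphic A (presented p)"
proof -
  have nA: "nominal_set (alphabet A) (letter_act A)" "orbit_finite (alphabet A) (letter_act A)"
    "nominal_set (states A) (state_act A)" "orbit_finite (states A) (state_act A)"
    and I: "initial A \<subseteq> states A" "\<And>\<pi>. state_act A \<pi> ` initial A = initial A"
    and F: "final A \<subseteq> states A" "\<And>\<pi>. state_act A \<pi> ` final A = final A"
    and D: "transitions A \<subseteq> states A \<times> alphabet A \<times> states A" "\<And>\<pi>. trans_act A \<pi> ` transitions A = transitions A"
    using A by (simp_all add: nominal_automaton_def equivariant_def)
  obtain ls f where ls: "\<forall>r\<in>set ls. wf_orbit r" and f: "bij_betw f (alphabet A) (elements ls)"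
    "\<And>\<pi> a. a \<in> alphabet A \<Longrightarrow> f (letter_act A \<pi> a) = element_act \<pi> (f a)"
    using nominal_set_presentable[OF nA(1,2)] by blast
  obtain os g where os: "\<forall>r\<in>set os. wf_orbit r" and g: "bij_betw g (states A) (elements os)"
    "\<And>\<pi> q. q \<in> states A \<Longrightarrow> g (state_act A \<pi> q) = element_act \<pi> (g q)"
    using nominal_set_presentable[OF nA(3,4)] by blast
  have J: "\<exists>J. set J \<subseteq> {..<length os} \<and> g ` U = element os ` {(i, t) \<in> names os. i \<in> set J}"
    if U: "U \<subseteq> states A" "\<And>\<pi>. state_act A \<pi> ` U = U" for U
  proof (rule invariant_names[OF os])
    show "g ` U \<subseteq> elements os" using U(1) g(1) by (auto simp: bij_betw_def)
    fix \<pi> e assume "e \<in> g ` U"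
    then obtain q where q: "q \<in> U" "e = g q" by blast
    have "state_act A \<pi> q \<in> U" using U(2) q(1) by blast
    moreover have "element_act \<pi> e = g (state_act A \<pi> q)" using g(2) q U(1) by auto
    ultimately show "element_act \<pi> e \<in> g ` U" by blast
  qed
  obtain Is where Is: "set Is \<subseteq> {..<length os}"
    "g ` initial A = element os ` {(i, t) \<in> names os. i \<in> set Is}" using J[OF I] by blast
  obtain Fs where Fs: "set Fs \<subseteq> {..<length os}"
    "g ` final A = element os ` {(i, t) \<in> names os. i \<in> set Fs}" using J[OF F] by blast
  let ?T = "(\<lambda>(q, a, q'). (g q, f a, g q')) ` transitions A"
  have "\<exists>D. set D \<subseteq> names os \<times> names ls \<times> names os \<and>
    ?T = {(element_act \<pi> (element os m), element_act \<pi> (element ls a), element_act \<pi> (element os n))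
         | \<pi> m a n. (m, a, n) \<in> set D}"
  proof (rule invariant_triples[OF os ls])
    have gs: "g q \<in> elements os" if "q \<in> states A" for q using g(1) that by (auto simp: bij_betw_def)
    have fs: "f a \<in> elements ls" if "a \<in> alphabet A" for a using f(1) that by (auto simp: bij_betw_def)
    show "?T \<subseteq> elements os \<times> elements ls \<times> elements os"
    proof
      fix w assume "w \<in> ?T"
      then obtain q a q' where q: "(q, a, q') \<in> transitions A" "w = (g q, f a, g q')" by auto
      have "q \<in> states A" "a \<in> alphabet A" "q' \<in> states A" using subsetD[OF D(1) q(1)] by simp_all
      then show "w \<in> elements os \<times> elements ls \<times> elements os" using gs fs q(2) by blast
    qed
    fix \<pi> x y z assume "(x, y, z) \<in> ?T"
    then obtain q a q' where q: "(q, a, q') \<in> transitions A" "x = g q" "y = f a" "z = g q'" by auto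
    have "trans_act A \<pi> (q, a, q') \<in> transitions A" using D(2)[of \<pi>] q(1) by blast
    then have "(state_act A \<pi> q, letter_act A \<pi> a, state_act A \<pi> q') \<in> transitions A"
      by (simp add: trans_act_def)
    then have "(g (state_act A \<pi> q), f (letter_act A \<pi> a), g (state_act A \<pi> q')) \<in> ?T"
      by (rule image_eqI[rotated]) simp
    moreover have "q \<in> states A" "a \<in> alphabet A" "q' \<in> states A"
      using subsetD[OF D(1) q(1)] by simp_all
    ultimately show "(element_act \<pi> x, element_act \<pi> y, element_act \<pi> z) \<in> ?T"
      by (simp only: q(2-4) f(2) g(2))
  qed
  then obtain Ds where Ds: "set Ds \<subseteq> names os \<times> names ls \<times> names os"
    "?T = {(element_act \<pi> (element os m), element_act \<pi> (element ls a), element_act \<pi> (element os n))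
         | \<pi> m a n. (m, a, n) \<in> set Ds}" by blast
  let ?p = "\<lparr>letter_orbits = ls, state_orbits = os, initial_orbits = Is, final_orbits = Fs, trans_reps = Ds\<rparr>"
  have "wf_presentation ?p" using ls os Is(1) Fs(1) Ds(1) by (simp add: wf_presentation_def)
  moreover have "isomorphic A (presented ?p)"
    unfolding isomorphic_def
    by (intro exI[of _ f] exI[of _ g])
      (simp only: presented_def automaton.simps presentation.simps f g Is(2) Fs(2) Ds(2), simp add: f(2) g(2))
  ultimately show ?thesis by blast
qed

theorem isomorphic_invariance:
  assumes A: "nominal_automaton A" and iso: "isomorphic A B"
  shows "residual A \<longleftrightarrow> residual B" and "universal A \<longleftrightarrow> universal B"
proof -
  have sub: "initial A \<subseteq> states A" "final A \<subseteq> states A"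
    "transitions A \<subseteq> states A \<times> alphabet A \<times> states A"
    using A by (simp_all add: nominal_automaton_def)
  obtain f g where f: "bij_betw f (alphabet A) (alphabet B)" and g: "bij_betw g (states A) (states B)"
    and img: "g ` initial A = initial B" "g ` final A = final B"
      "(\<lambda>(q, a, q'). (g q, f a, g q')) ` transitions A = transitions B"
    using iso unfolding isomorphic_def by (elim exE conjE) (rule that; assumption)
  have g_inj: "q = q'" if "g q = g q'" "q \<in> states A" "q' \<in> states A" for q q'
    using g that by (auto simp: bij_betw_def inj_on_def)
  have f_inj: "a = a'" if "f a = f a'" "a \<in> alphabet A" "a' \<in> alphabet A" for a a'
    using f that by (auto simp: bij_betw_def inj_on_def)
  have mf_inj: "inj_on (map f) (lists (alphabet A))"
    by (rule inj_on_map_lists) (use f in \<open>simp add: bij_betw_def\<close>)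
  have lists_B: "lists (alphabet B) = map f ` lists (alphabet A)"
  proof -
    have "alphabet B = f ` alphabet A" using f by (simp add: bij_betw_def)
    then show ?thesis by (simp only: lists_image)
  qed
  have fin: "g q \<in> final B \<longleftrightarrow> q \<in> final A" if "q \<in> states A" for q
    unfolding img(2)[symmetric] by (rule inj_on_image_mem_iff[OF _ that sub(2)])
      (use g in \<open>simp add: bij_betw_def\<close>)
  have acc: "accepts_from B (g q) (map f w) \<longleftrightarrow> accepts_from A q w"
    if "q \<in> states A" "w \<in> lists (alphabet A)" for q w
    using that
  proof (induction w arbitrary: q)
    case Nil
    then show ?case using fin by simp
  next
    case (Cons a w)
    have a: "a \<in> alphabet A" and w: "w \<in> lists (alphabet A)" using Cons.prems by auto
    show ?case
    proof
      assume "accepts_from B (g q) (map f (a # w))"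
      then obtain r where r: "(g q, f a, r) \<in> transitions B" "accepts_from B r (map f w)" by auto
      then obtain q1 a1 q' where t: "(q1, a1, q') \<in> transitions A" "g q = g q1" "f a = f a1" "r = g q'"
        unfolding img(3)[symmetric] by auto
      then have "q1 \<in> states A" "a1 \<in> alphabet A" and q': "q' \<in> states A" using sub(3) by auto
      then have "q1 = q" "a1 = a" using g_inj[of q1 q] f_inj[of a1 a] t a Cons.prems by auto
      then show "accepts_from A q (a # w)" using t r Cons.IH[OF q' w] by auto
    next
      assume "accepts_from A q (a # w)"
      then obtain q' where q': "(q, a, q') \<in> transitions A" "accepts_from A q' w" by auto
      have "(g q, f a, g q') \<in> transitions B"
        unfolding img(3)[symmetric] by (rule image_eqI[rotated, OF q'(1)]) simp
      moreover have "q' \<in> states A" using subsetD[OF sub(3) q'(1)] by simp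
      ultimately show "accepts_from B (g q) (map f (a # w))" using Cons.IH[of q'] q'(2) w by auto
    qed
  qed
  have sl: "state_language B (g q) = map f ` state_language A q" if "q \<in> states A" for q
    unfolding state_language_def lists_B using acc[OF that] by auto
  have lang: "language B = map f ` language A"
  proof -
    have "state_language B (g q) = map f ` state_language A q" if "q \<in> initial A" for q
      using sl that sub(1) by blast
    then show ?thesis
      unfolding language_def img(1)[symmetric] by (simp add: image_UN image_image)
  qed
  have lA: "language A \<subseteq> lists (alphabet A)" and sA: "state_language A q \<subseteq> lists (alphabet A)" for q
    by (auto simp: language_def state_language_def)
  show "universal A \<longleftrightarrow> universal B"
    unfolding universal_def lang lists_B using inj_on_image_eq_iff[OF mf_inj lA] by simp
  have quot: "{v. map f w @ v \<in> language B} = map f ` {v. w @ v \<in> language A}"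
    if w: "w \<in> lists (alphabet A)" for w
  proof (intro equalityI subsetI)
    fix v assume "v \<in> {v. map f w @ v \<in> language B}"
    then obtain u where u: "u \<in> language A" "map f w @ v = map f u" unfolding lang by blast
    then obtain u1 u2 where uu: "u = u1 @ u2" "map f w = map f u1" "v = map f u2"
      by (metis append_eq_map_conv)
    have "u1 \<in> lists (alphabet A)" using u lA uu by auto
    then have "w = u1" using inj_onD[OF mf_inj uu(2) w] by blast
    then show "v \<in> map f ` {v. w @ v \<in> language A}" using u uu by blast
  next
    fix v assume "v \<in> map f ` {v. w @ v \<in> language A}"
    then show "v \<in> {v. map f w @ v \<in> language B}" unfolding lang by (auto intro: image_eqI[rotated])
  qed
  have key: "state_language B (g q) = {v. map f w @ v \<in> language B} \<longleftrightarrow>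
      state_language A q = {v. w @ v \<in> language A}"
    if "q \<in> states A" "w \<in> lists (alphabet A)" for q w
  proof -
    have "{v. w @ v \<in> language A} \<subseteq> lists (alphabet A)" using lA by fastforce
    then show ?thesis
      unfolding sl[OF that(1)] quot[OF that(2)] using inj_on_image_eq_iff[OF mf_inj sA] by blast
  qed
  have "states B = g ` states A" using g by (simp add: bij_betw_def)
  then show "residual A \<longleftrightarrow> residual B"
    unfolding residual_def lists_B using key by simp
qed

end

theory Submission
  imports Defs
begin

text \<open>If \<open>\<L>(A) = \<Sigma>\<^sup>*\<close> and \<open>A\<close> is residual, every state accepts \<open>w\<^sup>-\<^sup>1\<Sigma>\<^sup>* = \<Sigma>\<^sup>*\<close>, so it is final and
  has a successor for every letter; and some state is initial. Conversely these three conditions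
  make every run extendable and accepting. They are equivariant, so only finitely many
  state-letter pairs have to be tested, and the test is a formula with bounded
  quantifiers over codes of lists and pairs.\<close>

section \<open>A calculus of total recursive functions\<close>

text \<open>The successor in a transition is only required to exist, so a representative
  \<open>(m, a, n)\<close> from \<open>trans_reps\<close> has to be compared with a given state and
  letter alone: some permutation must carry \<open>m\<close> and \<open>a\<close> to them modulo
  their orbit groups. The obstacle is this quantifier over infinitely many permutations. It
  disappears because permutations of atoms realise every correspondence between finite tuples that
  preserves and reflects equality, which leaves a search through the listed groups and comparisons
  of entries. The recursive function obtained is total, since each unbounded search in it has a
  witness for every argument. Well-formedness and residuality enter only the proof that its answer
  is right; the algorithm tests neither.\<close>

definition rec_fun :: "nat \<Rightarrow> (nat list \<Rightarrow> nat) \<Rightarrow> bool" where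
  "rec_fun n f \<longleftrightarrow> (\<exists>r. \<forall>xs. length xs = n \<longrightarrow> eval r xs = Some (f xs))"

definition rec_pred :: "nat \<Rightarrow> (nat list \<Rightarrow> bool) \<Rightarrow> bool" where
  "rec_pred n P \<longleftrightarrow> rec_fun n (\<lambda>xs. of_bool (P xs))"

lemma rec_funI:
  assumes "\<And>xs. length xs = n \<Longrightarrow> eval r xs = Some (f xs)"
  shows "rec_fun n f"
  using assms unfolding rec_fun_def by blast

text \<open>\<open>Comp\<close> is strict: one undefined argument makes the result undefined, so
  every argument must be known to be defined. Indexing by position suits argument lists built from
  \<open>map Proj\<close>.\<close>

lemma eval_Comp:
  assumes "\<And>i. i < length gs \<Longrightarrow> eval (gs ! i) xs = Some (ys ! i)" "length ys = length gs"
  shows "eval (Comp f gs) xs = eval f ys"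
proof -
  have "map (\<lambda>g. eval g xs) gs = map Some ys"
    by (rule nth_equalityI) (use assms in auto)
  then show ?thesis by (simp add: Let_def image_iff comp_def del: map_eq_conv)
qed

text \<open>Pushing the value of \<open>f\<close> onto the environment acts as a \<open>let\<close>:
  what is proved for the variable \<open>hd ys\<close> extends to arbitrary recursive
  arguments.\<close>

lemma rec_fun_subst:
  assumes "rec_fun (Suc n) (\<lambda>ys. F (hd ys) (tl ys))" "rec_fun n f"
  shows "rec_fun n (\<lambda>xs. F (f xs) xs)"
proof -
  obtain r where r: "\<And>xs. length xs = Suc n \<Longrightarrow> eval r xs = Some (F (hd xs) (tl xs))"
    using assms(1) unfolding rec_fun_def by blast
  obtain s where s: "\<And>xs. length xs = n \<Longrightarrow> eval s xs = Some (f xs)"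
    using assms(2) unfolding rec_fun_def by blast
  show ?thesis
  proof (rule rec_funI)
    fix xs :: "nat list" assume l: "length xs = n"
    have "eval (Comp r (s # map Proj [0..<n])) xs = eval r (f xs # xs)"
      by (rule eval_Comp) (auto simp: nth_Cons l s split: nat.split)
    then show "eval (Comp r (s # map Proj [0..<n])) xs = Some (F (f xs) xs)"
      using r[of "f xs # xs"] l by simp
  qed
qed

text \<open>Argument lists serve as environments: in the rules for binders, \<open>hd ys\<close> is the bound variable
  and \<open>tl ys\<close> the environment outside the binder, so that variables take the form
  \<open>hd (tl (\<dots> (tl ys)))\<close>.\<close>

lemma rec_fun_tl:
  assumes "rec_fun n f"
  shows "rec_fun (Suc n) (\<lambda>xs. f (tl xs))"
proof -
  obtain r where r: "\<And>xs. length xs = n \<Longrightarrow> eval r xs = Some (f xs)"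
    using assms unfolding rec_fun_def by blast
  show ?thesis
  proof (rule rec_funI)
    fix xs :: "nat list" assume l: "length xs = Suc n"
    have "eval (Comp r (map (\<lambda>i. Proj (Suc i)) [0..<n])) xs = eval r (tl xs)"
      by (rule eval_Comp) (auto simp: l nth_tl)
    then show "eval (Comp r (map (\<lambda>i. Proj (Suc i)) [0..<n])) xs = Some (f (tl xs))"
      using r[of "tl xs"] l by simp
  qed
qed

lemma rec_fun_hd: "rec_fun (Suc n) hd"
  by (rule rec_funI[where r = "Proj 0"]) (auto simp: length_Suc_conv)

text \<open>One rule per binder depth; the formula \<open>universal_code\<close> nests eight
  binders.\<close>

lemmas rec_fun_hd1 = rec_fun_tl[OF rec_fun_hd]
lemmas rec_fun_hd2 = rec_fun_tl[OF rec_fun_hd1]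
lemmas rec_fun_hd3 = rec_fun_tl[OF rec_fun_hd2]
lemmas rec_fun_hd4 = rec_fun_tl[OF rec_fun_hd3]
lemmas rec_fun_hd5 = rec_fun_tl[OF rec_fun_hd4]
lemmas rec_fun_hd6 = rec_fun_tl[OF rec_fun_hd5]
lemmas rec_fun_hd7 = rec_fun_tl[OF rec_fun_hd6]
lemmas rec_fun_hd8 = rec_fun_tl[OF rec_fun_hd7]

lemmas rec_fun_vars = rec_fun_hd rec_fun_hd1 rec_fun_hd2 rec_fun_hd3 rec_fun_hd4 rec_fun_hd5
  rec_fun_hd6 rec_fun_hd7 rec_fun_hd8

section \<open>Primitive recursion and arithmetic\<close>

lemma rec_fun_Suc:
  assumes "rec_fun n f"
  shows "rec_fun n (\<lambda>xs. Suc (f xs))"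
proof -
  have "rec_fun (Suc n) (\<lambda>ys. Suc (hd ys))"
  proof (rule rec_funI)
    fix xs :: "nat list" assume l: "length xs = Suc n"
    have "eval (Comp Succ [Proj 0]) xs = eval Succ [hd xs]"
      by (rule eval_Comp) (use l in \<open>auto simp: length_Suc_conv\<close>)
    then show "eval (Comp Succ [Proj 0]) xs = Some (Suc (hd xs))" by simp
  qed
  then show ?thesis by (rule rec_fun_subst) (rule assms)
qed

lemma rec_fun_const: "rec_fun n (\<lambda>xs. c)"
proof (induction c)
  case 0
  show ?case by (rule rec_funI[where r = Zero]) simp
qed (rule rec_fun_Suc)

text \<open>\<open>PrimRec\<close> places the counter and the previous value before the parameters,
  which is the environment extended by two bound variables. The recursion runs on a variable in
  front, for which \<open>k\<close> is then substituted.\<close>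

lemma rec_fun_primrec:
  assumes b: "rec_fun n b"
    and s: "rec_fun (Suc (Suc n)) (\<lambda>ys. s (hd ys) (hd (tl ys)) (tl (tl ys)))"
    and k: "rec_fun n k"
  shows "rec_fun n (\<lambda>xs. rec_nat (b xs) (\<lambda>m r. s m r xs) (k xs))"
proof -
  obtain rb where rb: "\<And>xs. length xs = n \<Longrightarrow> eval rb xs = Some (b xs)"
    using b unfolding rec_fun_def by blast
  obtain rs where rs: "\<And>xs. length xs = Suc (Suc n) \<Longrightarrow>
      eval rs xs = Some (s (hd xs) (hd (tl xs)) (tl (tl xs)))"
    using s unfolding rec_fun_def by blast
  have "rec_fun (Suc n) (\<lambda>ys. rec_nat (b (tl ys)) (\<lambda>m r. s m r (tl ys)) (hd ys))"
  proof (rule rec_funI)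
    fix xs :: "nat list" assume "length xs = Suc n"
    then obtain m ys where xs: "xs = m # ys" "length ys = n" by (auto simp: length_Suc_conv)
    have "rec_nat (eval rb ys)
        (\<lambda>m r. case r of None \<Rightarrow> None | Some y \<Rightarrow> eval rs (m # y # ys)) m =
      Some (rec_nat (b ys) (\<lambda>m r. s m r ys) m)"
      by (induction m) (simp_all add: rb rs xs(2))
    then show "eval (PrimRec rb rs) xs = Some (rec_nat (b (tl xs)) (\<lambda>m r. s m r (tl xs)) (hd xs))"
      by (simp add: xs(1))
  qed
  then show ?thesis by (rule rec_fun_subst) (rule k)
qed

lemma rec_fun_add:
  assumes "rec_fun n f" "rec_fun n g"
  shows "rec_fun n (\<lambda>xs. f xs + g xs)"
proof -
  have "rec_fun n (\<lambda>xs. rec_nat (f xs) (\<lambda>m r. Suc r) (g xs))"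
    by (intro rec_fun_primrec rec_fun_Suc rec_fun_vars assms)
  moreover have "rec_nat a (\<lambda>m r. Suc r) b = a + b" for a b :: nat
    by (induction b) simp_all
  ultimately show ?thesis by simp
qed

lemma rec_fun_mult:
  assumes "rec_fun n f" "rec_fun n g"
  shows "rec_fun n (\<lambda>xs. f xs * g xs)"
proof -
  have "rec_fun (Suc n) (\<lambda>ys. rec_nat 0 (\<lambda>m r. r + hd ys) (g (tl ys)))"
    by (intro rec_fun_primrec rec_fun_add rec_fun_const rec_fun_vars rec_fun_tl assms)
  then have "rec_fun n (\<lambda>xs. rec_nat 0 (\<lambda>m r. r + f xs) (g xs))"
    by (rule rec_fun_subst) (rule assms)
  moreover have "rec_nat 0 (\<lambda>m r. r + a) b = a * b" for a b :: nat
    by (induction b) simp_all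
  ultimately show ?thesis by simp
qed

lemma rec_fun_pred:
  assumes "rec_fun n f"
  shows "rec_fun n (\<lambda>xs. f xs - 1)"
proof -
  have "rec_fun n (\<lambda>xs. rec_nat 0 (\<lambda>m r. m) (f xs))"
    by (intro rec_fun_primrec rec_fun_const rec_fun_vars assms)
  moreover have "rec_nat 0 (\<lambda>m r. m) a = a - 1" for a :: nat
    by (cases a) simp_all
  ultimately show ?thesis by simp
qed

lemma rec_fun_diff:
  assumes "rec_fun n f" "rec_fun n g"
  shows "rec_fun n (\<lambda>xs. f xs - g xs)"
proof -
  have "rec_fun n (\<lambda>xs. rec_nat (f xs) (\<lambda>m r. r - 1) (g xs))"
    by (intro rec_fun_primrec rec_fun_pred rec_fun_vars assms)
  moreover have "rec_nat a (\<lambda>m r. r - 1) b = a - b" for a b :: nat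
    by (induction b) simp_all
  ultimately show ?thesis by simp
qed

section \<open>Recursive predicates, minimisation and bounded quantifiers\<close>

lemma rec_pred_le:
  assumes "rec_fun n f" "rec_fun n g"
  shows "rec_pred n (\<lambda>xs. f xs \<le> g xs)"
proof -
  have "rec_fun n (\<lambda>xs. 1 - (f xs - g xs))"
    by (intro rec_fun_diff rec_fun_const assms)
  moreover have "1 - (a - b) = of_bool (a \<le> b)" for a b :: nat by simp
  ultimately show ?thesis by (simp add: rec_pred_def)
qed

lemma rec_pred_conj:
  assumes "rec_pred n P" "rec_pred n Q"
  shows "rec_pred n (\<lambda>xs. P xs \<and> Q xs)"
  using rec_fun_mult[OF assms[unfolded rec_pred_def]] by (simp add: rec_pred_def of_bool_conj)

lemma rec_pred_not:
  assumes "rec_pred n P"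
  shows "rec_pred n (\<lambda>xs. \<not> P xs)"
proof -
  have "rec_fun n (\<lambda>xs. 1 - of_bool (P xs))"
    by (intro rec_fun_diff rec_fun_const assms[unfolded rec_pred_def])
  moreover have "1 - of_bool b = (of_bool (\<not> b) :: nat)" for b by simp
  ultimately show ?thesis by (simp add: rec_pred_def)
qed

lemma rec_pred_imp:
  assumes "rec_pred n P" "rec_pred n Q"
  shows "rec_pred n (\<lambda>xs. P xs \<longrightarrow> Q xs)"
  using rec_pred_not[OF rec_pred_conj[OF assms(1) rec_pred_not[OF assms(2)]]] by simp

lemma rec_pred_iff:
  assumes "rec_pred n P" "rec_pred n Q"
  shows "rec_pred n (\<lambda>xs. P xs \<longleftrightarrow> Q xs)"
  unfolding iff_conv_conj_imp by (intro rec_pred_conj rec_pred_imp assms)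

lemma rec_pred_eq:
  fixes f g :: "nat list \<Rightarrow> nat"
  assumes "rec_fun n f" "rec_fun n g"
  shows "rec_pred n (\<lambda>xs. f xs = g xs)"
  unfolding order_eq_iff by (intro rec_pred_conj rec_pred_le assms)

text \<open>\<open>Mu\<close> looks for a zero, hence the characteristic function of the negation is
  minimised. That function is defined everywhere, so only a missing witness could cause divergence,
  and \<open>ex\<close> excludes it.\<close>

lemma rec_fun_Least:
  assumes P: "rec_pred (Suc n) (\<lambda>ys. P (hd ys) (tl ys))" and ex: "\<And>xs. \<exists>y. P y xs"
  shows "rec_fun n (\<lambda>xs. LEAST y. P y xs)"
proof -
  obtain r where r: "\<And>xs. length xs = Suc n \<Longrightarrow> eval r xs = Some (of_bool (\<not> P (hd xs) (tl xs)))"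
    using rec_pred_not[OF P, unfolded rec_pred_def] unfolding rec_fun_def by blast
  show ?thesis
  proof (rule rec_funI)
    fix xs :: "nat list" assume l: "length xs = n"
    have e: "eval r (y # xs) = Some (of_bool (\<not> P y xs))" for y
      using r[of "y # xs"] l by simp
    have "(eval r (y # xs) = Some 0) = P y xs" for y
      by (simp add: e)
    then show "eval (Mu r) xs = Some (LEAST y. P y xs)"
      using ex[of xs] by (simp add: e)
  qed
qed

text \<open>Stopping at the bound as well makes the minimisation total: the least number that
  satisfies \<open>P\<close> or is at least the bound lies below the bound iff there is a witness
  below it.\<close>

lemma rec_pred_bex:
  assumes P: "rec_pred (Suc n) (\<lambda>ys. P (hd ys) (tl ys))" and b: "rec_fun n b"
  shows "rec_pred n (\<lambda>xs. \<exists>x<b xs. P x xs)"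
proof -
  have eq: "(\<exists>x<B. Q x) \<longleftrightarrow> \<not> B \<le> (LEAST x. Q x \<or> B \<le> x)" (is "_ \<longleftrightarrow> \<not> B \<le> ?m")
    for Q and B :: nat
  proof
    assume "\<exists>x<B. Q x"
    then obtain x where "x < B" "Q x" by blast
    then show "\<not> B \<le> ?m" using Least_le[of "\<lambda>x. Q x \<or> B \<le> x" x] by auto
  next
    assume m: "\<not> B \<le> ?m"
    have "Q ?m \<or> B \<le> ?m" by (rule LeastI[of _ B]) simp
    then show "\<exists>x<B. Q x" using m by (meson not_le)
  qed
  have "rec_pred (Suc n) (\<lambda>ys. \<not> (\<not> P (hd ys) (tl ys) \<and> \<not> b (tl ys) \<le> hd ys))"
    by (intro rec_pred_not rec_pred_conj rec_pred_le P rec_fun_tl b rec_fun_vars)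
  then have "rec_pred (Suc n) (\<lambda>ys. P (hd ys) (tl ys) \<or> b (tl ys) \<le> hd ys)" by simp
  then have "rec_fun n (\<lambda>xs. LEAST y. P y xs \<or> b xs \<le> y)"
    by (rule rec_fun_Least) auto
  then show ?thesis unfolding eq by (intro rec_pred_not rec_pred_le b)
qed

lemma rec_pred_ball:
  assumes "rec_pred (Suc n) (\<lambda>ys. P (hd ys) (tl ys))" "rec_fun n b"
  shows "rec_pred n (\<lambda>xs. \<forall>x<b xs. P x xs)"
proof -
  have "rec_pred n (\<lambda>xs. \<not> (\<exists>x<b xs. \<not> P x xs))"
    by (intro rec_pred_not rec_pred_bex assms)
  then show ?thesis by simp
qed

section \<open>Recursive operations on codes\<close>

definition pfst :: "nat \<Rightarrow> nat" where "pfst z = fst (prod_decode z)"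

definition psnd :: "nat \<Rightarrow> nat" where "psnd z = snd (prod_decode z)"

lemma pfst_prod_encode [simp]: "pfst (prod_encode (a, b)) = a"
  and psnd_prod_encode [simp]: "psnd (prod_encode (a, b)) = b"
  by (simp_all add: pfst_def psnd_def)

lemma prod_encode_pfst_psnd [simp]: "prod_encode (pfst z, psnd z) = z"
  by (simp add: pfst_def psnd_def)

text \<open>Doubling removes the division by two in \<open>triangle\<close>, so that the code of a
  pair solves a polynomial equation and can be found by search.\<close>

lemma two_prod_encode: "2 * prod_encode (a, b) = (a + b) * Suc (a + b) + 2 * a"
proof -
  have "2 * triangle k = k * Suc k" for k
    by (induction k) simp_all
  then show ?thesis by (simp add: prod_encode_def)
qed

lemma prod_encode_eq_iff:
  "prod_encode (a, b) = z \<longleftrightarrow> 2 * z = (a + b) * Suc (a + b) + 2 * a"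
  unfolding two_prod_encode[symmetric] by auto

lemma prod_encode_mono:
  assumes "a \<le> a'" "b \<le> b'"
  shows "prod_encode (a, b) \<le> prod_encode (a', b')"
proof -
  have "2 * prod_encode (a, b) \<le> 2 * prod_encode (a', b')"
    unfolding two_prod_encode using assms by (intro add_mono mult_mono) auto
  then show ?thesis by simp
qed

lemma rec_fun_prod_encode:
  assumes "rec_fun n f" "rec_fun n g"
  shows "rec_fun n (\<lambda>xs. prod_encode (f xs, g xs))"
proof -
  have "rec_fun n (\<lambda>xs. LEAST z. 2 * z = (f xs + g xs) * Suc (f xs + g xs) + 2 * f xs)"
    by (intro rec_fun_Least rec_pred_eq rec_fun_add rec_fun_mult rec_fun_Suc rec_fun_const
        rec_fun_tl assms rec_fun_vars) (rule exI, rule two_prod_encode)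
  moreover have "(LEAST z. prod_encode (a, b) = z) = prod_encode (a, b)" for a b
    by (rule Least_equality) auto
  ultimately show ?thesis unfolding prod_encode_eq_iff[symmetric] by simp
qed

lemma psnd_le: "psnd z \<le> z"
  using le_prod_encode_2[of "psnd z" "pfst z"] by simp

text \<open>The other component of a pair is at most its code, so the search condition for the first
  one needs only a bounded quantifier.\<close>

lemma rec_fun_pfst:
  assumes "rec_fun n f"
  shows "rec_fun n (\<lambda>xs. pfst (f xs))"
proof -
  have eq: "(\<exists>b<Suc z. prod_encode (a, b) = z) \<longleftrightarrow> a = pfst z" for a z
    using psnd_le[of z] by (metis le_imp_less_Suc pfst_prod_encode prod_encode_pfst_psnd)
  have "rec_pred (Suc n) (\<lambda>ys. \<exists>b<Suc (f (tl ys)). prod_encode (hd ys, b) = f (tl ys))"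
    by (intro rec_pred_bex rec_pred_eq rec_fun_prod_encode rec_fun_Suc rec_fun_tl assms rec_fun_vars)
  then have "rec_fun n (\<lambda>xs. LEAST a. \<exists>b<Suc (f xs). prod_encode (a, b) = f xs)"
    by (rule rec_fun_Least) (simp add: eq)
  moreover have "(LEAST a. a = c) = c" for c :: nat by (rule Least_equality) auto
  ultimately show ?thesis by (simp add: eq)
qed

lemma rec_fun_psnd:
  assumes "rec_fun n f"
  shows "rec_fun n (\<lambda>xs. psnd (f xs))"
proof -
  have eq: "prod_encode (pfst z, b) = z \<longleftrightarrow> b = psnd z" for b z
    by (metis psnd_prod_encode prod_encode_pfst_psnd)
  have "rec_pred (Suc n) (\<lambda>ys. prod_encode (pfst (f (tl ys)), hd ys) = f (tl ys))"
    by (intro rec_pred_eq rec_fun_prod_encode rec_fun_pfst rec_fun_tl assms rec_fun_vars)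
  then have "rec_fun n (\<lambda>xs. LEAST b. prod_encode (pfst (f xs), b) = f xs)"
    by (rule rec_fun_Least) (simp add: eq)
  moreover have "(LEAST a. a = c) = c" for c :: nat by (rule Least_equality) auto
  ultimately show ?thesis by (simp add: eq)
qed

section \<open>Codes of lists\<close>

text \<open>Since \<^term>\<open>list_encode (x # xs) = Suc (prod_encode (x, list_encode xs))\<close>, the code of the tail
  is the second component of the predecessor.\<close>

definition ldrop :: "nat \<Rightarrow> nat \<Rightarrow> nat" where
  "ldrop c i = rec_nat c (\<lambda>_ r. psnd (r - 1)) i"

definition lnth :: "nat \<Rightarrow> nat \<Rightarrow> nat" where
  "lnth c i = pfst (ldrop c i - 1)"

definition llen :: "nat \<Rightarrow> nat" where
  "llen c = (LEAST i. ldrop c i = 0)"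

definition lbex :: "nat \<Rightarrow> (nat \<Rightarrow> bool) \<Rightarrow> bool" where
  "lbex c P \<longleftrightarrow> (\<exists>i<llen c. P (lnth c i))"

lemma ldrop_list_encode [simp]: "ldrop (list_encode xs) i = list_encode (drop i xs)"
proof (induction i)
  case (Suc i)
  have "psnd (list_encode ys - 1) = list_encode (tl ys)" for ys
  proof (cases ys)
    case Nil
    \<comment> \<open>Here \<open>0 - 1 = 0\<close> and \<open>psnd 0 = 0\<close>: dropping past the
      end stays at 0, the code of the empty list.\<close>
    then show ?thesis using psnd_le[of 0] by simp
  qed simp
  then show ?case using Suc by (simp add: ldrop_def drop_Suc tl_drop)
qed (simp add: ldrop_def)

lemma list_encode_eq_0_iff [simp]: "list_encode xs = 0 \<longleftrightarrow> xs = []"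
  by (cases xs) simp_all

lemma lnth_list_encode [simp]: "i < length xs \<Longrightarrow> lnth (list_encode xs) i = xs ! i"
  by (simp add: lnth_def Cons_nth_drop_Suc[symmetric])

lemma llen_list_encode [simp]: "llen (list_encode xs) = length xs"
  unfolding llen_def by (rule Least_equality) auto

lemma lbex_list_encode [simp]: "lbex (list_encode xs) P \<longleftrightarrow> (\<exists>x\<in>set xs. P x)"
  unfolding lbex_def llen_list_encode in_set_conv_nth Bex_def
  by (metis lnth_list_encode)

lemma rec_fun_ldrop:
  assumes "rec_fun n f" "rec_fun n g"
  shows "rec_fun n (\<lambda>xs. ldrop (f xs) (g xs))"
  unfolding ldrop_def by (intro rec_fun_primrec rec_fun_psnd rec_fun_pred rec_fun_vars assms)

lemma rec_fun_lnth:
  assumes "rec_fun n f" "rec_fun n g"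
  shows "rec_fun n (\<lambda>xs. lnth (f xs) (g xs))"
  unfolding lnth_def by (intro rec_fun_pfst rec_fun_pred rec_fun_ldrop assms)

lemma rec_fun_llen:
  assumes "rec_fun n f"
  shows "rec_fun n (\<lambda>xs. llen (f xs))"
  unfolding llen_def
proof (rule rec_fun_Least)
  show "rec_pred (Suc n) (\<lambda>ys. ldrop (f (tl ys)) (hd ys) = 0)"
    by (intro rec_pred_eq rec_fun_ldrop rec_fun_const rec_fun_tl assms rec_fun_vars)
  fix xs
  \<comment> \<open>Every natural number is the code of some list, so the search for the length ends
    on all arguments.\<close>
  obtain ys where "f xs = list_encode ys" by (metis list_decode_inverse)
  then show "\<exists>i. ldrop (f xs) i = 0" by (auto intro: exI[of _ "length ys"])
qed

lemma rec_pred_lbex: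
  assumes P: "rec_pred (Suc n) (\<lambda>ys. P (hd ys) (tl ys))" and c: "rec_fun n c"
  shows "rec_pred n (\<lambda>xs. lbex (c xs) (\<lambda>x. P x xs))"
proof -
  \<comment> \<open>A slot for the index is inserted between the bound variable and the environment.
    The entry \<open>lnth (c xs) i\<close> can then be substituted for the bound variable while
    \<open>i\<close> stays available to the quantifier over positions.\<close>
  have "rec_fun (Suc (Suc n)) (\<lambda>zs. of_bool (P (hd zs) (tl (tl zs))))"
  proof -
    obtain r where r: "\<And>xs. length xs = Suc n \<Longrightarrow> eval r xs = Some (of_bool (P (hd xs) (tl xs)))"
      using P[unfolded rec_pred_def] unfolding rec_fun_def by blast
    show ?thesis
    proof (rule rec_funI)
      fix xs :: "nat list" assume l: "length xs = Suc (Suc n)"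
      let ?r = "Comp r (Proj 0 # map (\<lambda>i. Proj (Suc (Suc i))) [0..<n])"
      have "eval ?r xs = eval r (hd xs # tl (tl xs))"
        by (rule eval_Comp) (use l in \<open>auto simp: length_Suc_conv nth_Cons split: nat.split\<close>)
      then show "eval ?r xs = Some (of_bool (P (hd xs) (tl (tl xs))))"
        using r[of "hd xs # tl (tl xs)"] l by simp
    qed
  qed
  then have "rec_fun (Suc n) (\<lambda>ys. of_bool (P (lnth (c (tl ys)) (hd ys)) (tl ys)))"
    by (rule rec_fun_subst[where F = "\<lambda>x ys. of_bool (P x (tl ys))"])
      (intro rec_fun_lnth rec_fun_tl c rec_fun_vars)
  then show ?thesis
    unfolding lbex_def by (intro rec_pred_bex rec_fun_llen c) (simp add: rec_pred_def)
qed

text \<open>This is the code of the list of \<open>l\<close> copies of \<open>M\<close>. Since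
  pairing is monotone, no list of length \<open>l\<close> with entries at most \<open>M\<close> has
  a larger code, so a quantifier over such tuples becomes a bounded one over numbers.\<close>

definition code_bound :: "nat \<Rightarrow> nat \<Rightarrow> nat" where
  "code_bound M l = rec_nat 0 (\<lambda>_ r. Suc (prod_encode (M, r))) l"

lemma rec_fun_code_bound:
  assumes "rec_fun n f" "rec_fun n g"
  shows "rec_fun n (\<lambda>xs. code_bound (f xs) (g xs))"
  unfolding code_bound_def
  by (intro rec_fun_primrec rec_fun_Suc rec_fun_prod_encode rec_fun_const rec_fun_tl rec_fun_vars assms)

lemma list_encode_le_code_bound:
  "set xs \<subseteq> {..M} \<Longrightarrow> list_encode xs \<le> code_bound M (length xs)"
  by (induction xs) (auto simp: code_bound_def intro!: prod_encode_mono)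

lemmas rec_intros = rec_fun_const rec_fun_vars rec_fun_add rec_fun_Suc rec_fun_pfst rec_fun_psnd
  rec_fun_lnth rec_fun_llen rec_fun_code_bound
  rec_pred_eq rec_pred_conj rec_pred_not rec_pred_imp rec_pred_iff rec_pred_ball rec_pred_lbex

lemma decidable_under_promiseI:
  assumes "rec_pred 1 (\<lambda>xs. Q (hd xs))" "\<And>x. promise x \<Longrightarrow> Q (encode x) \<longleftrightarrow> P x"
  shows "decidable_under_promise encode promise P"
proof -
  obtain r where "\<And>xs. length xs = 1 \<Longrightarrow> eval r xs = Some (of_bool (Q (hd xs)))"
    using assms(1)[unfolded rec_pred_def] unfolding rec_fun_def by blast
  then have "eval r [encode x] = Some (if P x then 1 else 0)" if "promise x" for x
    using assms(2)[OF that] by simp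
  then show ?thesis unfolding decidable_under_promise_def by blast
qed

section \<open>Universality of residual automata\<close>

lemma universal_residual_iff:
  assumes A: "nominal_automaton A" and res: "residual A"
  shows "universal A \<longleftrightarrow> initial A \<noteq> {} \<and> states A \<subseteq> final A \<and>
    (\<forall>q\<in>states A. \<forall>a\<in>alphabet A. \<exists>q'. (q, a, q') \<in> transitions A)"
proof
  assume U: "universal A"
  have acc: "accepts_from A q v" if q: "q \<in> states A" and v: "v \<in> lists (alphabet A)" for q v
  proof -
    obtain w where "w \<in> lists (alphabet A)" "state_language A q = {v. w @ v \<in> language A}"
      using res q unfolding residual_def by blast
    then have "v \<in> state_language A q" using U v by (simp add: universal_def)
    then show ?thesis by (simp add: state_language_def)
  qed
  have "[] \<in> language A" using U by (simp add: universal_def)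
  then have "initial A \<noteq> {}" by (auto simp: language_def)
  moreover have "states A \<subseteq> final A" using acc[of _ "[]"] by auto
  moreover have "\<exists>q'. (q, a, q') \<in> transitions A" if "q \<in> states A" "a \<in> alphabet A" for q a
    using acc[of q "[a]"] that by auto
  ultimately show "initial A \<noteq> {} \<and> states A \<subseteq> final A \<and>
    (\<forall>q\<in>states A. \<forall>a\<in>alphabet A. \<exists>q'. (q, a, q') \<in> transitions A)" by blast
next
  assume R: "initial A \<noteq> {} \<and> states A \<subseteq> final A \<and>
    (\<forall>q\<in>states A. \<forall>a\<in>alphabet A. \<exists>q'. (q, a, q') \<in> transitions A)"
  have T: "initial A \<subseteq> states A" "transitions A \<subseteq> states A \<times> alphabet A \<times> states A"
    using A by (simp_all add: nominal_automaton_def)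
  have acc: "accepts_from A q v" if "q \<in> states A" "v \<in> lists (alphabet A)" for q v
    using that
  proof (induction v arbitrary: q)
    case Nil
    then show ?case using R by auto
  next
    case (Cons a v)
    then have "\<exists>q'. (q, a, q') \<in> transitions A" using R by simp
    then obtain q' where "(q, a, q') \<in> transitions A" by blast
    moreover from this have "q' \<in> states A" using T(2) by blast
    ultimately show ?case using Cons by auto
  qed
  obtain q where "q \<in> initial A" using R by blast
  then have "lists (alphabet A) \<subseteq> language A"
    using acc[of q] T(1) unfolding language_def state_language_def by blast
  then show "universal A"
    by (auto simp: universal_def language_def state_language_def)
qed

section \<open>Permutations, names and transitions\<close>

text \<open>Since \<open>perm_extend\<close> wants tuples without repetition, only the entries of
  \<open>t\<close> that do not occur in \<open>s\<close> are appended to \<open>s\<close>;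
  \<open>J\<close> holds their positions. By \<open>pat\<close>, the entries of \<open>v\<close> at
  these positions avoid \<open>u\<close>, and the atoms shared by \<open>s\<close> and
  \<open>t\<close> are already sent to the right place.\<close>

lemma perm_extend_pair:
  fixes s t u v :: "atom list"
  assumes d: "distinct s" "distinct t" "distinct u" "distinct v"
    and l: "length u = length s" "length v = length t"
    and pat: "\<And>x y. x < length s \<Longrightarrow> y < length t \<Longrightarrow> s ! x = t ! y \<longleftrightarrow> u ! x = v ! y"
  shows "\<exists>\<pi>. map (Perm.apply \<pi>) s = u \<and> map (Perm.apply \<pi>) t = v"
proof -
  define J where "J = filter (\<lambda>y. t ! y \<notin> set s) [0..<length t]"
  have J: "y < length t" "t ! y \<notin> set s" "v ! y \<notin> set u" if "y \<in> set J" for y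
    using that pat l by (auto simp: J_def in_set_conv_nth)
  have dJ: "distinct J" by (simp add: J_def)
  have inj: "inj_on ((!) t) (set J)" "inj_on ((!) v) (set J)"
    using J(1) d l by (auto simp: inj_on_def nth_eq_iff_index_eq)
  have "distinct (s @ map ((!) t) J)" "distinct (u @ map ((!) v) J)"
    using d J dJ inj by (auto simp: distinct_map)
  then obtain \<pi> where p: "map (Perm.apply \<pi>) (s @ map ((!) t) J) = u @ map ((!) v) J"
    using perm_extend[of "s @ map ((!) t) J" "u @ map ((!) v) J"] l by auto
  then have ps: "map (Perm.apply \<pi>) s = u" and pJ: "map (Perm.apply \<pi>) (map ((!) t) J) = map ((!) v) J"
    using l by simp_all
  have "Perm.apply \<pi> (t ! y) = v ! y" if y: "y < length t" for y
  proof (cases "t ! y \<in> set s")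
    case True
    then obtain x where x: "x < length s" "t ! y = s ! x" by (metis in_set_conv_nth)
    have "Perm.apply \<pi> (s ! x) = u ! x" using ps x(1) by (metis nth_map)
    then show ?thesis using pat[of x y] x y by simp
  next
    case False
    then have "y \<in> set J" using y by (simp add: J_def)
    then show ?thesis using pJ by simp
  qed
  then have "map (Perm.apply \<pi>) t = v" using l by (intro nth_equalityI) auto
  then show ?thesis using ps by blast
qed

lemma wf_orbitD:
  assumes "wf_orbit (k, G)"
  shows "[0..<k] \<in> set G" "g \<in> set G \<Longrightarrow> distinct g" "g \<in> set G \<Longrightarrow> set g = {..<k}"
    "g \<in> set G \<Longrightarrow> length g = k"
    "g \<in> set G \<Longrightarrow> h \<in> set G \<Longrightarrow> map ((!) g) h \<in> set G"
proof -
  show d: "[0..<k] \<in> set G" "g \<in> set G \<Longrightarrow> distinct g" "g \<in> set G \<Longrightarrow> set g = {..<k}"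
    "g \<in> set G \<Longrightarrow> h \<in> set G \<Longrightarrow> map ((!) g) h \<in> set G"
    using assms by (auto simp: wf_orbit_def)
  show "g \<in> set G \<Longrightarrow> length g = k"
    using d(2,3) distinct_card[of g] by simp
qed

lemma element_eq_iff:
  assumes wf: "wf_orbit (os ! i)" and s: "(i, s) \<in> names os" and t: "(i, t) \<in> names os"
  shows "element os (i, s) = element os (i, t) \<longleftrightarrow> (\<exists>g\<in>set (snd (os ! i)). s = map ((!) t) g)"
proof -
  obtain k G where kG: "os ! i = (k, G)" by fastforce
  note w = wf_orbitD[OF wf[unfolded kG]]
  have st: "length s = k" "length t = k" "distinct s" "distinct t"
    using s t by (auto simp: names_def kG)
  let ?E = "\<lambda>t. (\<lambda>g. map ((!) t) g) ` set G"
  have inj: "inj_on (\<lambda>g. map ((!) t) g) (set G)" if "length t = k" "distinct t" for t :: "atom list"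
  proof (rule inj_onI)
    fix g h assume gh: "g \<in> set G" "h \<in> set G" "map ((!) t) g = map ((!) t) h"
    have "inj_on ((!) t) (set g \<union> set h)"
      using w(3)[OF gh(1)] w(3)[OF gh(2)] that by (auto simp: inj_on_def nth_eq_iff_index_eq)
    then show "g = h" using gh(3) map_inj_on by blast
  qed
  have "?E s = ?E t \<longleftrightarrow> (\<exists>g\<in>set G. s = map ((!) t) g)"
  proof
    assume "?E s = ?E t"
    moreover have "s \<in> ?E s" using w(1) st(1) by (metis image_eqI map_nth)
    ultimately show "\<exists>g\<in>set G. s = map ((!) t) g" by blast
  next
    assume "\<exists>g\<in>set G. s = map ((!) t) g"
    then obtain g where g: "g \<in> set G" "s = map ((!) t) g" by blast
    have "?E s \<subseteq> ?E t"
    proof clarify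
      fix h assume h: "h \<in> set G"
      have "map ((!) s) h = map ((!) t) (map ((!) g) h)"
        using w(3)[OF h] w(4)[OF g(1)] g(2) by auto
      then show "map ((!) s) h \<in> ?E t" using w(5)[OF g(1) h] by blast
    qed
    \<comment> \<open>Closure under composition gives one inclusion. Counting replaces an argument
      with inverses for the other: both classes have as many elements as
      \<open>set G\<close>.\<close>
    moreover have "card (?E s) = card (?E t)"
      using inj[of s] inj[of t] st by (simp add: card_image)
    ultimately show "?E s = ?E t" by (intro card_subset_eq) auto
  qed
  then show ?thesis by (simp add: element_def kG setcompr_eq_image)
qed

text \<open>A permutation carries two tuples of distinct atoms to two others iff the equality patterns
  between the tuples agree, so the existence of a transition becomes a condition on patterns.\<close>

definition matching :: "presentation \<Rightarrow> nat \<Rightarrow> nat \<Rightarrow> (nat \<Rightarrow> atom) \<Rightarrow> (nat \<Rightarrow> atom) \<Rightarrow> bool" where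
  "matching p i j u v \<longleftrightarrow>
    (\<exists>m a n. (m, a, n) \<in> set (trans_reps p) \<and> fst m = i \<and> fst a = j \<and>
      (\<exists>g\<in>set (snd (state_orbits p ! i)). \<exists>h\<in>set (snd (letter_orbits p ! j)).
        \<forall>x<fst (state_orbits p ! i). \<forall>y<fst (letter_orbits p ! j).
          snd m ! x = snd a ! y \<longleftrightarrow> u (g ! x) = v (h ! y)))"

lemma wf_orbit_nth_less:
  assumes "wf_orbit r" "g \<in> set (snd r)" "x < fst r"
  shows "g ! x < fst r"
  using wf_orbitD(3,4)[of "fst r" "snd r" g] assms by (metis lessThan_iff nth_mem prod.collapse)

text \<open>Only equalities between entries matter, so \<open>u\<close> and \<open>v\<close> are
  functions on positions: a tuple read by \<open>(!)\<close>, the identity for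
  \<open>[0..<k]\<close>, or a code read by \<open>lnth\<close>. The group elements map positions to
  positions, so agreement below the arities is enough.\<close>

lemma matching_cong:
  assumes wf: "wf_orbit (state_orbits p ! i)" "wf_orbit (letter_orbits p ! j)"
    and eq: "\<And>x y. x < fst (state_orbits p ! i) \<Longrightarrow> y < fst (letter_orbits p ! j) \<Longrightarrow>
      u x = v y \<longleftrightarrow> u' x = v' y"
  shows "matching p i j u v \<longleftrightarrow> matching p i j u' v'"
proof -
  have "(\<forall>x<fst (state_orbits p ! i). \<forall>y<fst (letter_orbits p ! j). b x y \<longleftrightarrow> u (g ! x) = v (h ! y)) \<longleftrightarrow>
      (\<forall>x<fst (state_orbits p ! i). \<forall>y<fst (letter_orbits p ! j). b x y \<longleftrightarrow> u' (g ! x) = v' (h ! y))"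
    if "g \<in> set (snd (state_orbits p ! i))" "h \<in> set (snd (letter_orbits p ! j))" for g h b
    using eq wf_orbit_nth_less[OF wf(1) that(1)] wf_orbit_nth_less[OF wf(2) that(2)] by simp
  then show ?thesis
    unfolding matching_def by (intro ex_cong1 conj_cong bex_cong refl)
qed

text \<open>By \<open>element_eq_iff\<close>, equality of elements is equality of tuples up to some
  \<open>g\<close> and \<open>h\<close> from the two groups. The quantifier over permutations then
  moves inside those over \<open>g\<close> and \<open>h\<close>, where
  \<open>perm_extend_pair\<close> eliminates it.\<close>

lemma transition_iff:
  assumes wf: "wf_presentation p"
    and s: "(i, s) \<in> names (state_orbits p)" and t: "(j, t) \<in> names (letter_orbits p)"
  shows "(\<exists>q. (element (state_orbits p) (i, s), element (letter_orbits p) (j, t), q) \<in> transitions (presented p))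
    \<longleftrightarrow> matching p i j ((!) s) ((!) t)"
    (is "?L \<longleftrightarrow> _")
proof -
  let ?S = "state_orbits p" and ?A = "letter_orbits p"
  have wfS: "\<forall>r\<in>set ?S. wf_orbit r" and wfA: "\<forall>r\<in>set ?A. wf_orbit r"
    and reps: "set (trans_reps p) \<subseteq> names ?S \<times> names ?A \<times> names ?S"
    using wf by (auto simp: wf_presentation_def)
  obtain k G l H where kG: "?S ! i = (k, G)" and lH: "?A ! j = (l, H)" by fastforce
  have st: "i < length ?S" "length s = k" "distinct s" "j < length ?A" "length t = l" "distinct t"
    using s t by (auto simp: names_def kG lH)
  have wf_i: "wf_orbit (?S ! i)" and wf_j: "wf_orbit (?A ! j)"
    using wfS wfA st by auto
  note G = wf_orbitD[OF wf_i[unfolded kG]] and H = wf_orbitD[OF wf_j[unfolded lH]]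
  have key: "(\<exists>\<pi>. element ?S (i, s) = element_act \<pi> (element ?S m) \<and>
      element ?A (j, t) = element_act \<pi> (element ?A a)) \<longleftrightarrow> fst m = i \<and> fst a = j \<and>
      (\<exists>g\<in>set (snd (?S ! i)). \<exists>h\<in>set (snd (?A ! j)). \<forall>x<fst (?S ! i). \<forall>y<fst (?A ! j).
          snd m ! x = snd a ! y \<longleftrightarrow> s ! (g ! x) = t ! (h ! y))"
      (is "_ \<longleftrightarrow> ?R m a")
    if mem: "m \<in> names ?S" "a \<in> names ?A" for m a
  proof -
    obtain i' s' j' t' where ma: "m = (i', s')" "a = (j', t')" by fastforce
    show ?thesis
    proof (cases "i' = i \<and> j' = j")
      case False
      then show ?thesis by (auto simp: ma element_def element_act_def)
    next
      case True
      then have ij: "i' = i" "j' = j" by auto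
      have st': "length s' = k" "distinct s'" "length t' = l" "distinct t'"
        using mem by (auto simp: names_def ma ij kG lH)
      have mS: "(i, map (Perm.apply \<pi>) s') \<in> names ?S" and mA: "(j, map (Perm.apply \<pi>) t') \<in> names ?A" for \<pi>
        using names_act[OF mem(1), of \<pi>] names_act[OF mem(2), of \<pi>] by (simp_all add: ma ij)
      have S: "element ?S (i, s) = element_act \<pi> (element ?S m) \<longleftrightarrow>
          (\<exists>g\<in>set G. map (Perm.apply \<pi>) s' = map ((!) s) g)" for \<pi>
      proof -
        have e: "element_act \<pi> (element ?S m) = element ?S (i, map (Perm.apply \<pi>) s')"
          using element_act_element[OF wfS mem(1), of \<pi>] by (simp add: ma ij)
        show ?thesis
          unfolding e eq_commute[of "element ?S (i, s)"] element_eq_iff[OF wf_i mS s] kG snd_conv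
          by (rule refl)
      qed
      have A: "element ?A (j, t) = element_act \<pi> (element ?A a) \<longleftrightarrow>
          (\<exists>h\<in>set H. map (Perm.apply \<pi>) t' = map ((!) t) h)" for \<pi>
      proof -
        have e: "element_act \<pi> (element ?A a) = element ?A (j, map (Perm.apply \<pi>) t')"
          using element_act_element[OF wfA mem(2), of \<pi>] by (simp add: ma ij)
        show ?thesis
          unfolding e eq_commute[of "element ?A (j, t)"] element_eq_iff[OF wf_j mA t] lH snd_conv
          by (rule refl)
      qed
      have "(\<exists>\<pi>. map (Perm.apply \<pi>) s' = map ((!) s) g \<and> map (Perm.apply \<pi>) t' = map ((!) t) h) \<longleftrightarrow>
          (\<forall>x<k. \<forall>y<l. s' ! x = t' ! y \<longleftrightarrow> s ! (g ! x) = t ! (h ! y))"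
        if g: "g \<in> set G" and h: "h \<in> set H" for g h
      proof
        assume "\<exists>\<pi>. map (Perm.apply \<pi>) s' = map ((!) s) g \<and> map (Perm.apply \<pi>) t' = map ((!) t) h"
        then obtain \<pi> where p: "map (Perm.apply \<pi>) s' = map ((!) s) g" "map (Perm.apply \<pi>) t' = map ((!) t) h"
          by blast
        have "Perm.apply \<pi> (s' ! x) = s ! (g ! x)" if "x < k" for x
          using arg_cong[OF p(1), of "\<lambda>xs. xs ! x"] that st' G(4)[OF g] by simp
        moreover have "Perm.apply \<pi> (t' ! y) = t ! (h ! y)" if "y < l" for y
          using arg_cong[OF p(2), of "\<lambda>xs. xs ! y"] that st' H(4)[OF h] by simp
        ultimately show "\<forall>x<k. \<forall>y<l. s' ! x = t' ! y \<longleftrightarrow> s ! (g ! x) = t ! (h ! y)"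
          by (metis apply_inj)
      next
        assume pat: "\<forall>x<k. \<forall>y<l. s' ! x = t' ! y \<longleftrightarrow> s ! (g ! x) = t ! (h ! y)"
        show "\<exists>\<pi>. map (Perm.apply \<pi>) s' = map ((!) s) g \<and> map (Perm.apply \<pi>) t' = map ((!) t) h"
        proof (rule perm_extend_pair[OF st'(2,4)])
          show "distinct (map ((!) s) g)" "distinct (map ((!) t) h)"
            using G(2,3)[OF g] H(2,3)[OF h] st
            by (auto simp: distinct_map inj_on_def nth_eq_iff_index_eq)
        qed (use pat st' G(4)[OF g] H(4)[OF h] in auto)
      qed
      then have "(\<exists>g\<in>set G. \<exists>h\<in>set H. \<exists>\<pi>.
          map (Perm.apply \<pi>) s' = map ((!) s) g \<and> map (Perm.apply \<pi>) t' = map ((!) t) h) \<longleftrightarrow>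
          (\<exists>g\<in>set G. \<exists>h\<in>set H. \<forall>x<k. \<forall>y<l. s' ! x = t' ! y \<longleftrightarrow> s ! (g ! x) = t ! (h ! y))"
        by (intro bex_cong refl)
      then show ?thesis unfolding S A unfolding ma ij kG lH fst_conv snd_conv by blast
    qed
  qed
  have "(\<exists>m a n. (m, a, n) \<in> set (trans_reps p) \<and>
      (\<exists>\<pi>. element ?S (i, s) = element_act \<pi> (element ?S m) \<and> element ?A (j, t) = element_act \<pi> (element ?A a)))
    \<longleftrightarrow> (\<exists>m a n. (m, a, n) \<in> set (trans_reps p) \<and> ?R m a)"
  proof (intro ex_cong1 conj_cong[OF refl])
    fix m a n assume "(m, a, n) \<in> set (trans_reps p)"
    then have "m \<in> names ?S" "a \<in> names ?A" using reps by auto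
    then show "(\<exists>\<pi>. element ?S (i, s) = element_act \<pi> (element ?S m) \<and>
      element ?A (j, t) = element_act \<pi> (element ?A a)) \<longleftrightarrow> ?R m a" by (rule key)
  qed
  \<comment> \<open>A permutation that matches \<open>m\<close> and \<open>a\<close> also supplies
    the target, namely the image of \<open>n\<close>.\<close>
  moreover have "?L \<longleftrightarrow> (\<exists>m a n. (m, a, n) \<in> set (trans_reps p) \<and>
      (\<exists>\<pi>. element ?S (i, s) = element_act \<pi> (element ?S m) \<and> element ?A (j, t) = element_act \<pi> (element ?A a)))"
    unfolding presented_def automaton.simps by blast
  ultimately show ?thesis unfolding matching_def by simp
qed

text \<open>Up to the action, the state may be taken with representative \<open>[0, \<dots>, k - 1]\<close> and the
  letter with atoms below \<open>k + l\<close>, which leaves finitely many cases.\<close>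

lemma total_iff:
  assumes wf: "wf_presentation p"
  shows "(\<forall>q\<in>states (presented p). \<forall>a\<in>alphabet (presented p).
      \<exists>q'. (q, a, q') \<in> transitions (presented p)) \<longleftrightarrow>
    (\<forall>i<length (state_orbits p). \<forall>j<length (letter_orbits p).
      \<forall>c<Suc (code_bound (fst (state_orbits p ! i) + fst (letter_orbits p ! j)) (fst (letter_orbits p ! j))).
        (\<forall>y<fst (letter_orbits p ! j). \<forall>z<fst (letter_orbits p ! j). lnth c y = lnth c z \<longrightarrow> y = z) \<longrightarrow>
        matching p i j (\<lambda>x. x) (lnth c))"
    (is "?L \<longleftrightarrow> ?R")
proof -
  let ?S = "state_orbits p" and ?A = "letter_orbits p"
  have wfS: "wf_orbit (?S ! i)" if "i < length ?S" for i
    using wf that by (auto simp: wf_presentation_def)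
  have wfA: "wf_orbit (?A ! j)" if "j < length ?A" for j
    using wf that by (auto simp: wf_presentation_def)
  show ?thesis
  proof
    assume L: ?L
    show ?R
    proof (intro allI impI)
      fix i j c assume i: "i < length ?S" and j: "j < length ?A"
        and inj: "\<forall>y<fst (?A ! j). \<forall>z<fst (?A ! j). lnth c y = lnth c z \<longrightarrow> y = z"
      obtain k G l H where kG: "?S ! i = (k, G)" and lH: "?A ! j = (l, H)" by fastforce
      have s: "(i, [0..<k]) \<in> names ?S" using i by (simp add: names_def kG)
      \<comment> \<open>Whatever list \<open>c\<close> encodes, reading its entries at the first
        \<open>l\<close> positions gives a tuple, and \<open>inj\<close> makes it a tuple of
        distinct atoms.\<close>
      have t: "(j, map (lnth c) [0..<l]) \<in> names ?A"
        using j inj by (auto simp: names_def lH distinct_map inj_on_def)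
      have "\<exists>q. (element ?S (i, [0..<k]), element ?A (j, map (lnth c) [0..<l]), q)
          \<in> transitions (presented p)"
        using L s t by (simp add: presented_def)
      then have "matching p i j ((!) [0..<k]) ((!) (map (lnth c) [0..<l]))"
        unfolding transition_iff[OF wf s t] .
      also have "?this \<longleftrightarrow> matching p i j (\<lambda>x. x) (lnth c)"
        by (rule matching_cong[OF wfS[OF i] wfA[OF j]]) (simp add: kG lH)
      finally show "matching p i j (\<lambda>x. x) (lnth c)" .
    qed
  next
    assume R: ?R
    show ?L
    proof (intro ballI)
      fix q a assume "q \<in> states (presented p)" "a \<in> alphabet (presented p)"
      then obtain i s j t where q: "q = element ?S (i, s)" and s: "(i, s) \<in> names ?S"
        and a: "a = element ?A (j, t)" and t: "(j, t) \<in> names ?A"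
        by (auto simp: presented_def)
      obtain k G l H where kG: "?S ! i = (k, G)" and lH: "?A ! j = (l, H)" by fastforce
      have st: "i < length ?S" "length s = k" "distinct s" "j < length ?A" "length t = l" "distinct t"
        using s t by (auto simp: names_def kG lH)
      \<comment> \<open>\<open>B\<close> lists the atoms of \<open>s\<close> first and then the
        remaining ones of \<open>t\<close>. Sending it to an initial segment of the atoms takes
        \<open>s\<close> to \<open>[0..<k]\<close> exactly and keeps \<open>t\<close> below
        \<open>k + l\<close>.\<close>
      define B where "B = s @ filter (\<lambda>b. b \<notin> set s) t"
      have B: "distinct B" "set t \<subseteq> set B" "length B \<le> k + l"
        using st by (auto simp: B_def)
      obtain \<pi> where p: "map (Perm.apply \<pi>) B = [0..<length B]"
        using perm_extend[of B "[0..<length B]"] B by auto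
      have "map (Perm.apply \<pi>) s = take k (map (Perm.apply \<pi>) B)"
        using st by (simp add: B_def)
      also have "\<dots> = [0..<k]" unfolding p using st by (simp add: B_def)
      finally have ps: "map (Perm.apply \<pi>) s = [0..<k]" .
      let ?t = "map (Perm.apply \<pi>) t"
      have "Perm.apply \<pi> ` set B = {..<length B}"
        using arg_cong[OF p, of set] by auto
      moreover have "set ?t \<subseteq> Perm.apply \<pi> ` set B" using B(2) by auto
      ultimately have "set ?t \<subseteq> {..k + l}" using B(3) by auto
      then have "list_encode ?t < Suc (code_bound (k + l) l)"
        using list_encode_le_code_bound[of ?t "k + l"] st by simp
      moreover have "\<forall>y<l. \<forall>z<l. lnth (list_encode ?t) y = lnth (list_encode ?t) z \<longrightarrow> y = z"
        using st by (simp add: apply_inj nth_eq_iff_index_eq)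
      ultimately have "matching p i j (\<lambda>x. x) (lnth (list_encode ?t))"
        using R st(1,4) by (simp add: kG lH)
      also have "?this \<longleftrightarrow> matching p i j ((!) s) ((!) t)"
      proof (rule matching_cong[OF wfS[OF st(1)] wfA[OF st(4)]])
        fix x y assume "x < fst (?S ! i)" "y < fst (?A ! j)"
        then have xy: "x < length s" "y < length t" by (simp_all add: kG lH st)
        have "Perm.apply \<pi> (s ! x) = x"
          using arg_cong[OF ps, of "\<lambda>xs. xs ! x"] xy st by simp
        moreover have "Perm.apply \<pi> (t ! y) = lnth (list_encode ?t) y" using xy by simp
        ultimately show "x = lnth (list_encode ?t) y \<longleftrightarrow> s ! x = t ! y" by (metis apply_inj)
      qed
      finally show "\<exists>q'. (q, a, q') \<in> transitions (presented p)"
        unfolding q a transition_iff[OF wf s t] .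
    qed
  qed
qed

section \<open>Initial and final orbits\<close>

text \<open>No orbit is empty, since \<open>[0..<k]\<close> names one of its elements. The same
  witness serves for final states below, where the tag of an element gives back its orbit
  index.\<close>

lemma initial_presented_nonempty_iff:
  assumes "wf_presentation p"
  shows "initial (presented p) \<noteq> {} \<longleftrightarrow> initial_orbits p \<noteq> []"
proof
  assume "initial_orbits p \<noteq> []"
  then obtain i where i: "i \<in> set (initial_orbits p)" by (meson last_in_set)
  moreover from this have "i < length (state_orbits p)"
    using assms by (auto simp: wf_presentation_def)
  ultimately have "(i, [0..<fst (state_orbits p ! i)]) \<in>
      {(i, t) \<in> names (state_orbits p). i \<in> set (initial_orbits p)}"
    by (simp add: names_def)
  then show "initial (presented p) \<noteq> {}" unfolding presented_def by auto
qed (auto simp: presented_def)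

lemma states_presented_final_iff:
  "states (presented p) \<subseteq> final (presented p) \<longleftrightarrow>
    (\<forall>i<length (state_orbits p). i \<in> set (final_orbits p))"
proof
  assume sub: "states (presented p) \<subseteq> final (presented p)"
  show "\<forall>i<length (state_orbits p). i \<in> set (final_orbits p)"
  proof (intro allI impI)
    fix i assume "i < length (state_orbits p)"
    then have "(i, [0..<fst (state_orbits p ! i)]) \<in> names (state_orbits p)"
      by (simp add: names_def)
    then have "element (state_orbits p) (i, [0..<fst (state_orbits p ! i)]) \<in> final (presented p)"
      using sub by (auto simp: presented_def)
    then show "i \<in> set (final_orbits p)" by (auto simp: presented_def element_def)
  qed
qed (auto simp: presented_def names_def)

section \<open>The test on codes of presentations\<close>

text \<open>The indices 0 to 4 follow the order of fields in \<open>encode_presentation\<close>, and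
  \<open>lnth c 2 = 0\<close> detects an empty list because only \<open>[]\<close> has code 0. The
  number \<open>d\<close> codes the letter tuple. Apart from its constants and variables, the
  formula uses only operations covered by \<open>rec_intros\<close>.\<close>

definition universal_code :: "nat \<Rightarrow> bool" where
  "universal_code c \<longleftrightarrow>
    \<not> lnth c 2 = 0 \<and>
    (\<forall>i<llen (lnth c 1). lbex (lnth c 3) (\<lambda>j. i = j)) \<and>
    (\<forall>i<llen (lnth c 1). \<forall>j<llen (lnth c 0).
      \<forall>d<Suc (code_bound (pfst (lnth (lnth c 1) i) + pfst (lnth (lnth c 0) j)) (pfst (lnth (lnth c 0) j))).
        (\<forall>y<pfst (lnth (lnth c 0) j). \<forall>z<pfst (lnth (lnth c 0) j). lnth d y = lnth d z \<longrightarrow> y = z) \<longrightarrow>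
        lbex (lnth c 4) (\<lambda>r. pfst (pfst r) = i \<and> pfst (pfst (psnd r)) = j \<and>
          lbex (psnd (lnth (lnth c 1) i)) (\<lambda>g. lbex (psnd (lnth (lnth c 0) j)) (\<lambda>h.
            \<forall>x<pfst (lnth (lnth c 1) i). \<forall>y<pfst (lnth (lnth c 0) j).
              lnth (psnd (pfst r)) x = lnth (psnd (pfst (psnd r))) y \<longleftrightarrow> lnth g x = lnth d (lnth h y)))))"

lemma rec_pred_universal_code: "rec_pred 1 (\<lambda>xs. universal_code (hd xs))"
  unfolding universal_code_def One_nat_def by (intro rec_intros)

lemma universal_code_encode_presentation:
  assumes wf: "wf_presentation p"
  shows "universal_code (encode_presentation p) \<longleftrightarrow>
    initial (presented p) \<noteq> {} \<and> states (presented p) \<subseteq> final (presented p) \<and>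
    (\<forall>q\<in>states (presented p). \<forall>a\<in>alphabet (presented p). \<exists>q'. (q, a, q') \<in> transitions (presented p))"
proof -
  let ?S = "state_orbits p" and ?A = "letter_orbits p"
  let ?c = "encode_presentation p"
  have c: "lnth ?c 0 = list_encode (map encode_orbit ?A)" "lnth ?c 1 = list_encode (map encode_orbit ?S)"
    "lnth ?c 2 = list_encode (initial_orbits p)" "lnth ?c 3 = list_encode (final_orbits p)"
    "lnth ?c 4 = list_encode (map encode_rep (trans_reps p))"
    by (simp_all add: encode_presentation_def del: list_encode.simps)
  have o: "pfst (encode_orbit r) = fst r" "psnd (encode_orbit r) = list_encode (map list_encode (snd r))" for r
    by (simp_all add: encode_orbit_def split: prod.split)
  \<comment> \<open>The function \<open>v\<close> stands for \<open>lnth d\<close>.\<close>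
  have m: "lbex (list_encode (map encode_rep (trans_reps p))) (\<lambda>r. pfst (pfst r) = i \<and> pfst (pfst (psnd r)) = j \<and>
          lbex (psnd (encode_orbit (?S ! i))) (\<lambda>g. lbex (psnd (encode_orbit (?A ! j))) (\<lambda>h.
            \<forall>x<fst (?S ! i). \<forall>y<fst (?A ! j).
              lnth (psnd (pfst r)) x = lnth (psnd (pfst (psnd r))) y \<longleftrightarrow> lnth g x = v (lnth h y)))) \<longleftrightarrow>
      matching p i j (\<lambda>x. x) v"
      (is "?l \<longleftrightarrow> _") if ij: "i < length ?S" "j < length ?A" for i j v
  proof -
    \<comment> \<open>\<open>lnth\<close> is known to agree with \<open>!\<close> only below the
      length of the list, so well-formedness has to provide the lengths of all lists that are
      read.\<close>
    have G: "length g = fst (?S ! i)" if "g \<in> set (snd (?S ! i))" for g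
      using wf_orbitD(4)[of "fst (?S ! i)" "snd (?S ! i)" g] wf ij(1) that
      by (simp add: wf_presentation_def)
    have H: "length h = fst (?A ! j)" if "h \<in> set (snd (?A ! j))" for h
      using wf_orbitD(4)[of "fst (?A ! j)" "snd (?A ! j)" h] wf ij(2) that
      by (simp add: wf_presentation_def)
    have r: "pfst (pfst (encode_rep (m, a, n))) = fst m" "psnd (pfst (encode_rep (m, a, n))) = list_encode (snd m)"
      "pfst (pfst (psnd (encode_rep (m, a, n)))) = fst a"
      "psnd (pfst (psnd (encode_rep (m, a, n)))) = list_encode (snd a)" for m a n
      by (simp_all add: encode_rep_def encode_name_def split: prod.split)
    have "?l \<longleftrightarrow> (\<exists>m a n. (m, a, n) \<in> set (trans_reps p) \<and> fst m = i \<and> fst a = j \<and>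
      (\<exists>g\<in>set (snd (?S ! i)). \<exists>h\<in>set (snd (?A ! j)). \<forall>x<fst (?S ! i). \<forall>y<fst (?A ! j).
          lnth (list_encode (snd m)) x = lnth (list_encode (snd a)) y \<longleftrightarrow>
          lnth (list_encode g) x = v (lnth (list_encode h) y)))"
      by (simp add: o r Bex_def[of "set (trans_reps p)"])
    also have "\<dots> \<longleftrightarrow> matching p i j (\<lambda>x. x) v"
      unfolding matching_def
    proof (intro ex_cong1 conj_cong bex_cong refl all_cong1 imp_cong)
      fix m a n g h x y
      assume "(m, a, n) \<in> set (trans_reps p)" "fst m = i" "fst a = j"
        "g \<in> set (snd (?S ! i))" "h \<in> set (snd (?A ! j))" "x < fst (?S ! i)" "y < fst (?A ! j)"
      moreover from this have "length (snd m) = fst (?S ! i)" "length (snd a) = fst (?A ! j)"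
        using wf by (auto simp: wf_presentation_def names_def)
      ultimately show "(lnth (list_encode (snd m)) x = lnth (list_encode (snd a)) y \<longleftrightarrow>
          lnth (list_encode g) x = v (lnth (list_encode h) y)) \<longleftrightarrow>
        (snd m ! x = snd a ! y \<longleftrightarrow> g ! x = v (h ! y))"
        by (simp add: G H)
    qed
    finally show ?thesis .
  qed
  have f: "lbex (list_encode (final_orbits p)) (\<lambda>j. i = j) \<longleftrightarrow> i \<in> set (final_orbits p)" for i
    by auto
  show ?thesis
    unfolding initial_presented_nonempty_iff[OF wf] states_presented_final_iff
      total_iff[OF wf] universal_code_def c
    by (simp add: o(1) m f del: lbex_list_encode)
qed

theorem proposition5p1:
  shows "decidable_under_promise encode_presentation
           (\<lambda>p. wf_presentation p \<and> residual (presented p))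
           (\<lambda>p. universal (presented p))"
  by (rule decidable_under_promiseI[OF rec_pred_universal_code])
    (simp add: universal_code_encode_presentation universal_residual_iff nominal_automaton_presented)

end
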